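(* There exists a choice of parameters $\gamma\ge 1$ and $0<R^*<1/2$ such that the algorithm which runs both Algorithm PMR (defined in the context) with parameters $\gamma,R^*$ and the Random Partitioning algorithm, and outputs the one of the two resulting trees with larger $Rev$, is an $\alpha$-approximation algorithm for maximizing $Rev(T)$, where $\alpha=0.6929$.
   Context: Instance: a finite set $V$ of $n$ items (vertices of $G=(V,E)$) with nonnegative dissimilarity weights $w_{i,j}=w_{j,i}$; $W=\sum_{(i,j)\in E} w_{i,j}$. A hierarchical clustering tree $T$ is a rooted tree with leaf set $V$, each internal node representing the cluster of leaves below it; $T_{i,j}$ is the subtree rooted at the least common ancestor of $i,j$, $|T_{i,j}|$ its number of leaves, and $Rev(T)=\sum_{i,j\in[n]} w_{i,j}|T_{i,j}|$; $OPT=\max_T Rev(T)$. An $\alpha$-approximation algorithm outputs $T$ with (expected) $Rev(T)\ge\alpha\cdot OPT$. Random Partitioning: recursively split every cluster with at least two items into two nonempty parts by a uniformly random partition (each item placed independently and uniformly on one of two sides, repeating if a side is empty), until all clusters are singletons. Algorithm PMR ("Peel-off first, Max-Cut or Random next") with parameters $\gamma\ge 1$, $0<R^*<1/2$: set $V_B\leftarrow V$, $E_B\leftarrow E$. While some $v\in V_B$ has $W_v=\sum_{u\in V_B,(v,u)\in E_B} w_{v,u}\ge \gamma\frac{2W}{n}$ (with $W$ and $n$ the original values, never updated), choose $v^*\in V_B$ with the largest $W_v$, split the current cluster $V_B$ into children $\{v^*\}$ and $V_B\setminus\{v^*\}$, remove $v^*$ from $V_B$ and remove all edges incident to $v^*$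 from $E_B$. Afterwards let $W_R=W-\sum_{(v,u)\in E_B}w_{v,u}$ and $R=W_R/W$. If $R>R^*$, run Random Partitioning on $V_B$. Otherwise, run the Goemans–Williamson approximate max-cut algorithm on $(V_B,E_B)$, split $V_B$ into the two sides of the returned cut, and run Random Partitioning on each side.
   Formalization: Trees, hence OPT, are binary: else the star has Rev nW and the claim fails on large unit-weight complete graphs. Peeling stops at one vertex, R is 0 if W=0, and if the cut has an empty side Random Partitioning is run on V_B. *)

theory Defs
  imports "HOL-Probability.Probability"
begin

section \<open>Hierarchical clustering trees and revenue\<close>

text \<open>
  The items are \<open>{..<n}\<close>. The graph is given by its weight function alone: a pair that is not an
  edge has weight 0, and values \<open>w i i\<close> are never used. Splits are binary; with unbounded arity the
  star would always be an optimal tree.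
\<close>

datatype 'a htree = Leaf 'a | Node "'a htree" "'a htree"

fun leaves :: "'a htree \<Rightarrow> 'a set" where
  "leaves (Leaf a) = {a}"
| "leaves (Node l r) = leaves l \<union> leaves r"

fun distinct_leaves :: "'a htree \<Rightarrow> bool" where
  "distinct_leaves (Leaf a) \<longleftrightarrow> True"
| "distinct_leaves (Node l r) \<longleftrightarrow>
     leaves l \<inter> leaves r = {} \<and> distinct_leaves l \<and> distinct_leaves r"

definition clustering_tree :: "'a set \<Rightarrow> 'a htree \<Rightarrow> bool" where
  "clustering_tree V T \<longleftrightarrow> leaves T = V \<and> distinct_leaves T"

fun lca_subtree :: "'a \<Rightarrow> 'a \<Rightarrow> 'a htree \<Rightarrow> 'a htree" where
  "lca_subtree i j (Leaf a) = Leaf a"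
| "lca_subtree i j (Node l r) =
     (if {i, j} \<subseteq> leaves l then lca_subtree i j l
      else if {i, j} \<subseteq> leaves r then lca_subtree i j r
      else Node l r)"

definition edges :: "nat set \<Rightarrow> (nat \<times> nat) set" where
  "edges V = {(i, j). i \<in> V \<and> j \<in> V \<and> i < j}"

definition weighted_instance :: "nat \<Rightarrow> (nat \<Rightarrow> nat \<Rightarrow> real) \<Rightarrow> bool" where
  "weighted_instance n w \<longleftrightarrow> 1 \<le> n \<and> (\<forall>i<n. \<forall>j<n. 0 \<le> w i j \<and> w i j = w j i)"

definition total_weight :: "(nat \<Rightarrow> nat \<Rightarrow> real) \<Rightarrow> nat set \<Rightarrow> real" where
  "total_weight w V = (\<Sum>(i, j)\<in>edges V. w i j)"

definition Rev :: "nat \<Rightarrow> (nat \<Rightarrow> nat \<Rightarrow> real) \<Rightarrow> nat htree \<Rightarrow> real" where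
  "Rev n w T = (\<Sum>(i, j)\<in>edges {..<n}. w i j * real (card (leaves (lca_subtree i j T))))"

definition OPT :: "nat \<Rightarrow> (nat \<Rightarrow> nat \<Rightarrow> real) \<Rightarrow> real" where
  "OPT n w = Max (Rev n w ` {T. clustering_tree {..<n} T})"

lemma finite_clustering_trees: "finite V \<Longrightarrow> finite {T. clustering_tree V T}"
proof (induction V rule: finite_psubset_induct)
  case (psubset V)
  define F where "F = (\<Union>A\<in>{A. A \<subset> V}. {T. clustering_tree A T})"
  have ne: "leaves T \<noteq> {}" for T :: "'a htree"
    by (induction T) auto
  have fin: "finite F"
    unfolding F_def using psubset
    by (intro finite_UN_I) (auto intro: finite_subset[of _ "Pow V"])
  have "{T. clustering_tree V T} \<subseteq> Leaf ` V \<union> (\<lambda>(l, r). Node l r) ` (F \<times> F)"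
  proof
    fix T assume "T \<in> {T. clustering_tree V T}"
    then have T: "leaves T = V" "distinct_leaves T" by (auto simp: clustering_tree_def)
    show "T \<in> Leaf ` V \<union> (\<lambda>(l, r). Node l r) ` (F \<times> F)"
    proof (cases T)
      case (Leaf a)
      with T show ?thesis by auto
    next
      case (Node l r)
      with T ne[of l] ne[of r] have "leaves l \<subset> V" "leaves r \<subset> V"
        "distinct_leaves l" "distinct_leaves r"
        by auto
      then have "l \<in> F" "r \<in> F" by (auto simp: F_def clustering_tree_def)
      with Node show ?thesis by auto
    qed
  qed
  moreover have "finite (Leaf ` V \<union> (\<lambda>(l, r). Node l r) ` (F \<times> F))"
    using fin psubset.hyps by auto
  ultimately show ?case by (rule finite_subset)
qed


section \<open>Random Partitioning\<close>

text \<open>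
  Placing the items of \<open>V\<close> independently and uniformly on two sides, conditioned on both sides
  being nonempty, makes the first side uniform among the nonempty proper subsets of \<open>V\<close>.
\<close>

lemma set_pmf_bipartition:
  assumes "\<not> card V < 2"
  shows "finite V"
    and "set_pmf (pmf_of_set {A. A \<subseteq> V \<and> A \<noteq> {} \<and> A \<noteq> V}) = {A. A \<subseteq> V \<and> A \<noteq> {} \<and> A \<noteq> V}"
proof -
  show fin: "finite V" using assms by (cases "finite V") simp_all
  have "V \<noteq> {}" using assms by (intro notI) simp
  then obtain x where x: "x \<in> V" by (rule ex_in_conv[THEN iffD2, THEN exE])
  have "{x} \<noteq> V" using assms by (intro notI) (drule sym, simp)
  with x have "{x} \<in> {A. A \<subseteq> V \<and> A \<noteq> {} \<and> A \<noteq> V}" by simp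
  then have ne: "{A. A \<subseteq> V \<and> A \<noteq> {} \<and> A \<noteq> V} \<noteq> {}" by (rule ex_in_conv[THEN iffD1, OF exI])
  have "{A. A \<subseteq> V \<and> A \<noteq> {} \<and> A \<noteq> V} \<subseteq> Pow V" by (rule subsetI) simp
  from finite_subset[OF this] fin have "finite {A. A \<subseteq> V \<and> A \<noteq> {} \<and> A \<noteq> V}" by simp
  with ne show "set_pmf (pmf_of_set {A. A \<subseteq> V \<and> A \<noteq> {} \<and> A \<noteq> V}) = {A. A \<subseteq> V \<and> A \<noteq> {} \<and> A \<noteq> V}"
    by (rule set_pmf_of_set)
qed

function random_partitioning :: "nat set \<Rightarrow> nat htree pmf" where
  "random_partitioning V =
     (if card V < 2 then return_pmf (Leaf (the_elem V))
      else bind_pmf (pmf_of_set {A. A \<subseteq> V \<and> A \<noteq> {} \<and> A \<noteq> V}) (\<lambda>A.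
           bind_pmf (random_partitioning A) (\<lambda>l.
           bind_pmf (random_partitioning (V - A)) (\<lambda>r.
           return_pmf (Node l r)))))"
  by auto
termination
proof (relation "Wellfounded.measure card", goal_cases)
  case 1
  show ?case by simp
next
  case (2 V A)
  note V = set_pmf_bipartition[OF 2(1)]
  from 2(2) have "A \<subset> V" unfolding V(2) by (simp add: psubset_eq)
  then show ?case using V(1) by (simp add: psubset_card_mono)
next
  case (3 V A l)
  note V = set_pmf_bipartition[OF 3(1)]
  from 3(2) have "A \<subseteq> V" "A \<noteq> {}" unfolding V(2) by simp_all
  then have "V - A \<subset> V" by blast
  then show ?case using V(1) by (simp add: psubset_card_mono)
qed

declare random_partitioning.simps [simp del]


section \<open>The Goemans--Williamson algorithm\<close>

definition dotp :: "nat \<Rightarrow> (nat \<Rightarrow> real) \<Rightarrow> (nat \<Rightarrow> real) \<Rightarrow> real" where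
  "dotp d x y = (\<Sum>k<d. x k * y k)"

definition sdp_feasible :: "nat set \<Rightarrow> (nat \<Rightarrow> nat \<Rightarrow> real) \<Rightarrow> bool" where
  "sdp_feasible B x \<longleftrightarrow> (\<forall>i\<in>B. dotp (card B) (x i) (x i) = 1)"

definition sdp_value ::
    "(nat \<Rightarrow> nat \<Rightarrow> real) \<Rightarrow> nat set \<Rightarrow> (nat \<Rightarrow> nat \<Rightarrow> real) \<Rightarrow> real" where
  "sdp_value w B x = (\<Sum>(i, j)\<in>edges B. w i j * ((1 - dotp (card B) (x i) (x j)) / 2))"

definition sdp_optimal ::
    "(nat \<Rightarrow> nat \<Rightarrow> real) \<Rightarrow> nat set \<Rightarrow> (nat \<Rightarrow> nat \<Rightarrow> real) \<Rightarrow> bool" where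
  "sdp_optimal w B x \<longleftrightarrow>
     sdp_feasible B x \<and> (\<forall>y. sdp_feasible B y \<longrightarrow> sdp_value w B y \<le> sdp_value w B x)"

definition std_gaussian :: "nat \<Rightarrow> (nat \<Rightarrow> real) measure" where
  "std_gaussian d = PiM {..<d} (\<lambda>_. density lborel (\<lambda>t. ennreal (std_normal_density t)))"

definition hyperplane_side :: "nat set \<Rightarrow> (nat \<Rightarrow> nat \<Rightarrow> real) \<Rightarrow> (nat \<Rightarrow> real) \<Rightarrow> nat set" where
  "hyperplane_side B x r = {i \<in> B. 0 \<le> dotp (card B) (x i) r}"

text \<open>
  The side of the cut depends only on the direction of \<open>r\<close>, which for a standard Gaussian vector
  is uniform on the unit sphere.
\<close>

definition hyperplane_rounding :: "nat set \<Rightarrow> (nat \<Rightarrow> nat \<Rightarrow> real) \<Rightarrow> nat set pmf" where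
  "hyperplane_rounding B x = embed_pmf (\<lambda>S.
     measure (std_gaussian (card B))
       {r \<in> space (std_gaussian (card B)). hyperplane_side B x r = S})"

lemma prob_space_std_gaussian: "prob_space (std_gaussian d)"
  unfolding std_gaussian_def
  by (intro prob_space_PiM prob_space_normal_density) simp

lemma hyperplane_side_event:
  assumes "finite B"
  shows "{r \<in> space (std_gaussian (card B)). hyperplane_side B x r = S} \<in> sets (std_gaussian (card B))"
proof -
  let ?M = "std_gaussian (card B)"
  have m: "(\<lambda>r. dotp (card B) (x i) r) \<in> borel_measurable ?M" for i
    unfolding dotp_def std_gaussian_def by measurable
  have "{r \<in> space ?M. hyperplane_side B x r = S} =
        {r \<in> space ?M. S \<subseteq> B \<and> (\<forall>i\<in>B. (i \<in> S) = (0 \<le> dotp (card B) (x i) r))}"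
    by (auto simp: hyperplane_side_def)
  also have "\<dots> \<in> sets ?M"
    using m assms by measurable
  finally show ?thesis .
qed

lemma pmf_hyperplane_rounding:
  assumes fin: "finite B"
  shows "pmf (hyperplane_rounding B x) S =
    measure (std_gaussian (card B))
      {r \<in> space (std_gaussian (card B)). hyperplane_side B x r = S}"
proof -
  let ?M = "std_gaussian (card B)"
  let ?E = "\<lambda>S. {r \<in> space ?M. hyperplane_side B x r = S}"
  interpret prob_space ?M by (rule prob_space_std_gaussian)
  have "(\<integral>\<^sup>+S. ennreal (measure ?M (?E S)) \<partial>count_space UNIV) =
        (\<integral>\<^sup>+S. ennreal (measure ?M (?E S)) \<partial>count_space (Pow B))"
  proof (rule nn_integral_count_space_eq)
    fix S assume "S \<in> UNIV - Pow B"
    then have "?E S = {}" by (auto simp: hyperplane_side_def)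
    then show "ennreal (measure ?M (?E S)) = 0" by (metis ennreal_0 measure_empty)
  qed auto
  also have "\<dots> = ennreal (\<Sum>S\<in>Pow B. measure ?M (?E S))"
    using fin by (simp add: nn_integral_count_space_finite sum_ennreal)
  also have "(\<Sum>S\<in>Pow B. measure ?M (?E S)) = measure ?M (\<Union>S\<in>Pow B. ?E S)"
    using fin hyperplane_side_event[OF fin]
    by (intro finite_measure_finite_Union[symmetric]) (simp_all add: disjoint_family_on_def image_subset_iff disjoint_iff)
  also have "(\<Union>S\<in>Pow B. ?E S) = space ?M"
  proof -
    have "hyperplane_side B x r \<in> Pow B" for r by (auto simp: hyperplane_side_def)
    then show ?thesis by blast
  qed
  finally have "(\<integral>\<^sup>+S. ennreal (measure ?M (?E S)) \<partial>count_space UNIV) = 1"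
    by (simp add: prob_space)
  then show ?thesis
    unfolding hyperplane_rounding_def by (subst pmf_embed_pmf) simp_all
qed


section \<open>Algorithm PMR\<close>

text \<open>
  An algorithm maps an instance to the set of its possible output distributions. There can be
  several of them because ties between vertices of largest weighted degree, and between optimal
  solutions of the semidefinite program, are broken arbitrarily.
\<close>

type_synonym clustering_algorithm = "nat \<Rightarrow> (nat \<Rightarrow> nat \<Rightarrow> real) \<Rightarrow> nat htree pmf set"

definition vertex_weight :: "(nat \<Rightarrow> nat \<Rightarrow> real) \<Rightarrow> nat set \<Rightarrow> nat \<Rightarrow> real" where
  "vertex_weight w B v = (\<Sum>u\<in>B - {v}. w v u)"

text \<open>
  \<open>peel_off n w \<gamma> V vs B\<close>: started on the cluster \<open>V\<close>, the loop peels off the vertices \<open>vs\<close> in this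
  order and ends with the cluster \<open>B\<close>. The test \<open>2 \<le> card V\<close> only matters if the total weight is 0:
  otherwise the vertex of a singleton cluster is never heavy.
\<close>

definition heavy :: "nat \<Rightarrow> (nat \<Rightarrow> nat \<Rightarrow> real) \<Rightarrow> real \<Rightarrow> nat set \<Rightarrow> nat \<Rightarrow> bool" where
  "heavy n w \<gamma> V v \<longleftrightarrow>
     2 \<le> card V \<and> v \<in> V \<and> vertex_weight w V v \<ge> \<gamma> * (2 * total_weight w {..<n} / real n)"

inductive peel_off ::
    "nat \<Rightarrow> (nat \<Rightarrow> nat \<Rightarrow> real) \<Rightarrow> real \<Rightarrow> nat set \<Rightarrow> nat list \<Rightarrow> nat set \<Rightarrow> bool"
  for n w \<gamma> where
  stop: "(\<nexists>v. heavy n w \<gamma> V v) \<Longrightarrow> peel_off n w \<gamma> V [] V"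
| peel: "heavy n w \<gamma> V v \<Longrightarrow> (\<forall>u\<in>V. vertex_weight w V u \<le> vertex_weight w V v) \<Longrightarrow>
         peel_off n w \<gamma> (V - {v}) vs B \<Longrightarrow> peel_off n w \<gamma> V (v # vs) B"

definition attach_peeled :: "nat list \<Rightarrow> nat htree \<Rightarrow> nat htree" where
  "attach_peeled vs T = foldr (\<lambda>v. Node (Leaf v)) vs T"

text \<open>A cut with an empty side does not split the cluster.\<close>

definition cut_then_random :: "nat set \<Rightarrow> nat set \<Rightarrow> nat htree pmf" where
  "cut_then_random B S =
     (if S = {} \<or> S = B then random_partitioning B
      else bind_pmf (random_partitioning S) (\<lambda>l.
           bind_pmf (random_partitioning (B - S)) (\<lambda>r.
           return_pmf (Node l r))))"

definition removed_fraction :: "nat \<Rightarrow> (nat \<Rightarrow> nat \<Rightarrow> real) \<Rightarrow> nat set \<Rightarrow> real" where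
  "removed_fraction n w B =
     (total_weight w {..<n} - total_weight w B) / total_weight w {..<n}"

definition PMR :: "real \<Rightarrow> real \<Rightarrow> clustering_algorithm" where
  "PMR \<gamma> Rstar n w =
     {map_pmf (attach_peeled vs) (random_partitioning B) | vs B.
        peel_off n w \<gamma> {..<n} vs B \<and> removed_fraction n w B > Rstar} \<union>
     {map_pmf (attach_peeled vs) (bind_pmf (hyperplane_rounding B x) (cut_then_random B)) | vs B x.
        peel_off n w \<gamma> {..<n} vs B \<and> \<not> removed_fraction n w B > Rstar \<and> sdp_optimal w B x}"

definition better_tree ::
    "nat \<Rightarrow> (nat \<Rightarrow> nat \<Rightarrow> real) \<Rightarrow> nat htree \<Rightarrow> nat htree \<Rightarrow> nat htree" where
  "better_tree n w T1 T2 = (if Rev n w T1 \<ge> Rev n w T2 then T1 else T2)"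

definition best_of_PMR_and_random :: "real \<Rightarrow> real \<Rightarrow> clustering_algorithm" where
  "best_of_PMR_and_random \<gamma> Rstar n w =
     {bind_pmf P (\<lambda>T1. bind_pmf (random_partitioning {..<n}) (\<lambda>T2.
        return_pmf (better_tree n w T1 T2))) | P. P \<in> PMR \<gamma> Rstar n w}"

definition approximation_algorithm :: "real \<Rightarrow> clustering_algorithm \<Rightarrow> bool" where
  "approximation_algorithm \<alpha> Alg \<longleftrightarrow>
     (\<forall>n w. weighted_instance n w \<longrightarrow>
        Alg n w \<noteq> {} \<and>
        (\<forall>D\<in>Alg n w.
           (\<forall>T\<in>set_pmf D. clustering_tree {..<n} T) \<and>
           measure_pmf.expectation D (Rev n w) \<ge> \<alpha> * OPT n w))"

end

theory Submission
  imports Defs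
begin

text \<open>
  We take \<open>\<gamma> = 3/2\<close> and \<open>Rstar = 0.22\<close>. Let \<open>W\<close> be the total weight and \<open>OPT = (1 - \<epsilon>) n W\<close>. Random
  Partitioning earns at least \<open>2/3 n W\<close>, which suffices unless \<open>\<epsilon> \<le> 0.0379\<close>. Peeling removes a
  fraction \<open>R\<close> of the weight in at most \<open>R n / (2\<gamma>)\<close> steps and hence earns at least
  \<open>R (1 - R / (4\<gamma>)) n W\<close> on it. If \<open>R > Rstar\<close>, this gain over the factor 2/3 is large enough on its own.
  Otherwise let \<open>Z\<close> be the value of the semidefinite program on the remaining cluster \<open>B\<close>, of weight
  \<open>(1 - R) W\<close>; it bounds every cut of \<open>B\<close> and is at least half of the weight. Following an optimal tree
  from the root into the larger child gives a sequence of cuts of \<open>B\<close>; because the degrees in \<open>B\<close>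
  are at most \<open>2\<gamma>W/n\<close>, a heavy later cut forces many vertices to have been split off before it, so
  that \<open>Z ((1 - R) W - Z) \<le> 2\<gamma>\<epsilon> W\<^sup>2\<close>. This forces \<open>Z \<ge> (1 - R - 5.2 \<epsilon>) W\<close>, and hyperplane rounding
  turns \<open>Z\<close> into a cut of expected weight at least \<open>0.85 Z\<close>.
\<close>

section \<open>Linear forms of a Gaussian vector\<close>

text \<open>A nearly optimal tree need not contain a good cut: if all weight sits on a clique of k
  vertices, k large but far below \<open>n\<close>, splitting these off one by one earns almost n W,
  while every cut holds only about half of the weight. Peeling removes this obstacle. Once degrees
  are at most q = 2 \<gamma> W / n, cuts of total weight s cannot be made without splitting off s /
  q vertices, so later cuts lose revenue and most of the weight must lie in a single cut. The choice
  of \<gamma> is a trade-off: a larger value peels fewer vertices but weakens the degree cap.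

  The cut inequality is proved for the semidefinite value and not for the maximum cut, because the
  rounding guarantee refers to the former; all that enters is that Z dominates every cut and lies
  between half of the remaining weight and q n / 2. Being quadratic, the inequality leaves two
  ranges for Z, a small one and one close to the full weight; the lower bound by one half selects
  the second. The final estimates have slack, which is why a rounding constant below the optimal
  one, provable from one tangent and one chord of the sine, is enough.\<close>

definition std_normal_measure :: "real measure" where
  "std_normal_measure = density lborel (\<lambda>t. ennreal (std_normal_density t))"

lemma prob_space_std_normal: "prob_space std_normal_measure"
  unfolding std_normal_measure_def by (rule prob_space_normal_density) simp

lemma sets_std_normal [measurable_cong, simp]: "sets std_normal_measure = sets borel"
  by (simp add: std_normal_measure_def)

lemma space_std_normal [simp]: "space std_normal_measure = UNIV"
  by (simp add: std_normal_measure_def)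

lemma nn_integral_std_normal:
  "f \<in> borel_measurable borel \<Longrightarrow>
   (\<integral>\<^sup>+x. f x \<partial>std_normal_measure) = (\<integral>\<^sup>+x. ennreal (std_normal_density x) * f x \<partial>lborel)"
  unfolding std_normal_measure_def by (subst nn_integral_density) auto

lemma sigma_finite_std_normal: "sigma_finite_measure std_normal_measure"
  using prob_space_std_normal
  by (simp add: prob_space_def finite_measure_def)

lemma Fubini_std_normal:
  fixes f :: "real \<times> real \<Rightarrow> ennreal"
  assumes [measurable]: "f \<in> borel_measurable (borel \<Otimes>\<^sub>M borel)"
  shows "(\<integral>\<^sup>+x. \<integral>\<^sup>+y. f (x, y) \<partial>std_normal_measure \<partial>std_normal_measure) =
         (\<integral>\<^sup>+y. \<integral>\<^sup>+x. f (x, y) \<partial>std_normal_measure \<partial>std_normal_measure)"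
proof -
  have "pair_sigma_finite std_normal_measure std_normal_measure"
    by (intro pair_sigma_finite.intro sigma_finite_std_normal)
  from pair_sigma_finite.Fubini[OF this, of f] show ?thesis by simp
qed

lemma Fubini_lborel:
  fixes f :: "real \<Rightarrow> real \<Rightarrow> ennreal"
  assumes [measurable]: "(\<lambda>(x, y). f x y) \<in> borel_measurable (borel \<Otimes>\<^sub>M borel)"
  shows "(\<integral>\<^sup>+x. \<integral>\<^sup>+y. f x y \<partial>lborel \<partial>lborel) = (\<integral>\<^sup>+y. \<integral>\<^sup>+x. f x y \<partial>lborel \<partial>lborel)"
proof -
  have "pair_sigma_finite (lborel :: real measure) (lborel :: real measure)" ..
  from pair_sigma_finite.Fubini[OF this, of "\<lambda>(x, y). f x y"] show ?thesis by simp
qed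

lemma nn_integral_std_normal2:
  fixes f :: "real \<Rightarrow> real \<Rightarrow> ennreal"
  assumes [measurable]: "(\<lambda>(x, y). f x y) \<in> borel_measurable (borel \<Otimes>\<^sub>M borel)"
  shows "(\<integral>\<^sup>+x. \<integral>\<^sup>+y. f x y \<partial>std_normal_measure \<partial>std_normal_measure) =
     (\<integral>\<^sup>+x. \<integral>\<^sup>+y. ennreal (std_normal_density x * std_normal_density y) * f x y \<partial>lborel \<partial>lborel)"
proof -
  have "(\<integral>\<^sup>+x. \<integral>\<^sup>+y. f x y \<partial>std_normal_measure \<partial>std_normal_measure) =
     (\<integral>\<^sup>+x. ennreal (std_normal_density x) * (\<integral>\<^sup>+y. ennreal (std_normal_density y) * f x y \<partial>lborel) \<partial>lborel)"
    by (subst nn_integral_std_normal) (measurable, simp add: nn_integral_std_normal)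
  also have "\<dots> = (\<integral>\<^sup>+x. \<integral>\<^sup>+y. ennreal (std_normal_density x * std_normal_density y) * f x y \<partial>lborel \<partial>lborel)"
    by (simp add: ennreal_mult mult.assoc nn_integral_cmult)
  finally show ?thesis .
qed

section \<open>Reflection and rotation invariance of the Gaussian plane\<close>

lemma std_normal_reflect:
  assumes "s = 1 \<or> s = (-1::real)" and [measurable]: "f \<in> borel_measurable borel"
  shows "(\<integral>\<^sup>+x. f (s * x) \<partial>std_normal_measure) = (\<integral>\<^sup>+x. f x \<partial>std_normal_measure)"
  using assms(1)
proof
  assume s: "s = -1"
  show ?thesis
    using nn_integral_real_affine[of "\<lambda>x. ennreal (std_normal_density x) * f x" "-1" 0]
    by (simp add: nn_integral_std_normal s std_normal_density_def)
qed simp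

lemma std_normal_density_rotate:
  assumes "a\<^sup>2 + b\<^sup>2 = (1::real)"
  shows "std_normal_density (a * s - b * t) * std_normal_density (b * s + a * t) =
         std_normal_density s * std_normal_density t"
proof -
  have "(a * s - b * t)\<^sup>2 + (b * s + a * t)\<^sup>2 = (a\<^sup>2 + b\<^sup>2) * (s\<^sup>2 + t\<^sup>2)"
    by (simp add: power2_eq_square algebra_simps)
  then have "- (a * s - b * t)\<^sup>2 / 2 + - (b * s + a * t)\<^sup>2 / 2 = - s\<^sup>2 / 2 + - t\<^sup>2 / 2"
    using assms by (simp add: field_simps)
  then have "exp (- (a * s - b * t)\<^sup>2 / 2) * exp (- (b * s + a * t)\<^sup>2 / 2) =
      exp (- s\<^sup>2 / 2) * exp (- t\<^sup>2 / 2)"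
    by (metis exp_add)
  then show ?thesis
    by (simp add: std_normal_density_def)
qed

text \<open>A rotation with \<open>a \<noteq> 0\<close> factors into two one-dimensional affine
  substitutions: first \<open>s = a * u + b * v\<close> at fixed \<open>v\<close>, then
  \<open>v = b * s + a * t\<close> at fixed \<open>s\<close>, with Fubini in between. Their factors
  \<open>\<bar>1 / a\<bar>\<close> and \<open>\<bar>a\<bar>\<close> cancel. For \<open>a = 0\<close>
  the map exchanges the coordinates up to sign, so Fubini and reflection suffice.\<close>

lemma std_normal_rotate:
  fixes f :: "real \<times> real \<Rightarrow> ennreal"
  assumes ab: "a\<^sup>2 + b\<^sup>2 = 1" and [measurable]: "f \<in> borel_measurable (borel \<Otimes>\<^sub>M borel)"
  shows "(\<integral>\<^sup>+u. \<integral>\<^sup>+v. f (a * u + b * v, a * v - b * u) \<partial>std_normal_measure \<partial>std_normal_measure) =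
         (\<integral>\<^sup>+u. \<integral>\<^sup>+v. f (u, v) \<partial>std_normal_measure \<partial>std_normal_measure)"
proof (cases "a = 0")
  case True
  interpret sigma_finite_measure std_normal_measure by (rule sigma_finite_std_normal)
  from True ab have b: "b = 1 \<or> b = -1" by (simp add: power2_eq_1_iff)
  then have b': "- b = 1 \<or> - b = -1" by auto
  have "(\<integral>\<^sup>+u. \<integral>\<^sup>+v. f (a * u + b * v, a * v - b * u) \<partial>std_normal_measure \<partial>std_normal_measure) =
    (\<integral>\<^sup>+u. \<integral>\<^sup>+v. f (b * v, (- b) * u) \<partial>std_normal_measure \<partial>std_normal_measure)"
    using True by simp
  also have "\<dots> = (\<integral>\<^sup>+u. \<integral>\<^sup>+v. f (v, (- b) * u) \<partial>std_normal_measure \<partial>std_normal_measure)"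
    by (intro nn_integral_cong std_normal_reflect b) measurable
  also have "\<dots> = (\<integral>\<^sup>+u. \<integral>\<^sup>+v. f (v, u) \<partial>std_normal_measure \<partial>std_normal_measure)"
    by (intro std_normal_reflect[OF b', of "\<lambda>u. \<integral>\<^sup>+v. f (v, u) \<partial>std_normal_measure"]) measurable
  also have "\<dots> = (\<integral>\<^sup>+u. \<integral>\<^sup>+v. f (u, v) \<partial>std_normal_measure \<partial>std_normal_measure)"
    by (intro Fubini_std_normal[symmetric]) measurable
  finally show ?thesis .
next
  case a: False
  let ?g = std_normal_density
  have "(\<integral>\<^sup>+u. \<integral>\<^sup>+v. f (a * u + b * v, a * v - b * u) \<partial>std_normal_measure \<partial>std_normal_measure) =
    (\<integral>\<^sup>+u. \<integral>\<^sup>+v. ennreal (?g u * ?g v) * f (a * u + b * v, a * v - b * u) \<partial>lborel \<partial>lborel)"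
    by (subst nn_integral_std_normal2) measurable
  also have "\<dots> = (\<integral>\<^sup>+v. \<integral>\<^sup>+u. ennreal (?g u * ?g v) * f (a * u + b * v, a * v - b * u) \<partial>lborel \<partial>lborel)"
    by (intro Fubini_lborel) measurable
  also have "\<dots> = (\<integral>\<^sup>+v. ennreal \<bar>1 / a\<bar> * (\<integral>\<^sup>+s. ennreal (?g ((s - b * v) / a) * ?g v) *
      f (s, a * v - b * ((s - b * v) / a)) \<partial>lborel) \<partial>lborel)"
  proof (intro nn_integral_cong)
    fix v :: real
    have aff: "- (b * v) / a + 1 / a * s = (s - b * v) / a" for s
      using a by (simp add: field_simps)
    have inv: "a * ((s - b * v) / a) + b * v = s" for s using a by simp
    show "(\<integral>\<^sup>+u. ennreal (?g u * ?g v) * f (a * u + b * v, a * v - b * u) \<partial>lborel) =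
      ennreal \<bar>1 / a\<bar> * (\<integral>\<^sup>+s. ennreal (?g ((s - b * v) / a) * ?g v) *
      f (s, a * v - b * ((s - b * v) / a)) \<partial>lborel)"
      using a by (subst nn_integral_real_affine[where c = "1 / a" and t = "- (b * v) / a"])
        (measurable, simp_all only: aff inv)
  qed
  also have "\<dots> = (\<integral>\<^sup>+v. \<integral>\<^sup>+s. ennreal \<bar>1 / a\<bar> * (ennreal (?g ((s - b * v) / a) * ?g v) *
      f (s, a * v - b * ((s - b * v) / a))) \<partial>lborel \<partial>lborel)"
    by (intro nn_integral_cong nn_integral_cmult[symmetric]) measurable
  also have "\<dots> = (\<integral>\<^sup>+s. \<integral>\<^sup>+v. ennreal \<bar>1 / a\<bar> * (ennreal (?g ((s - b * v) / a) * ?g v) *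
      f (s, a * v - b * ((s - b * v) / a))) \<partial>lborel \<partial>lborel)"
    by (intro Fubini_lborel) measurable
  also have "\<dots> = (\<integral>\<^sup>+s. \<integral>\<^sup>+t. ennreal (?g s * ?g t) * f (s, t) \<partial>lborel \<partial>lborel)"
  proof (rule nn_integral_cong)
    fix s :: real
    have e1: "(s - b * (b * s + a * t)) / a = a * s - b * t" for t
    proof -
      have "s - b * (b * s + a * t) = (1 - b\<^sup>2) * s - a * b * t"
        by (simp add: power2_eq_square algebra_simps)
      also have "1 - b\<^sup>2 = a\<^sup>2" using ab by simp
      finally show ?thesis using a by (simp add: field_simps power2_eq_square)
    qed
    have e2: "a * (b * s + a * t) - b * (a * s - b * t) = t" for t
    proof -
      have "a * (b * s + a * t) - b * (a * s - b * t) = (a\<^sup>2 + b\<^sup>2) * t"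
        by (simp add: power2_eq_square algebra_simps)
      then show ?thesis using ab by simp
    qed
    have c: "ennreal \<bar>a\<bar> * (ennreal \<bar>1 / a\<bar> * x) = x" for x
    proof -
      have "ennreal \<bar>a\<bar> * ennreal \<bar>1 / a\<bar> = 1"
        using a by (simp add: ennreal_mult[symmetric] abs_mult[symmetric])
      then show ?thesis by (simp add: mult.assoc[symmetric])
    qed
    have "(\<integral>\<^sup>+v. ennreal \<bar>1 / a\<bar> * (ennreal (?g ((s - b * v) / a) * ?g v) *
      f (s, a * v - b * ((s - b * v) / a))) \<partial>lborel) =
      ennreal \<bar>a\<bar> * (\<integral>\<^sup>+t. ennreal \<bar>1 / a\<bar> * (ennreal (?g s * ?g t) * f (s, t)) \<partial>lborel)"
      using a by (subst nn_integral_real_affine[where c = a and t = "b * s"])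
        (measurable, simp_all only: e1 e2 std_normal_density_rotate[OF ab])
    also have "\<dots> = (\<integral>\<^sup>+t. ennreal (?g s * ?g t) * f (s, t) \<partial>lborel)"
      by (subst nn_integral_cmult) (measurable, rule c)
    finally show "(\<integral>\<^sup>+v. ennreal \<bar>1 / a\<bar> * (ennreal (?g ((s - b * v) / a) * ?g v) *
      f (s, a * v - b * ((s - b * v) / a))) \<partial>lborel) =
      (\<integral>\<^sup>+t. ennreal (?g s * ?g t) * f (s, t) \<partial>lborel)" .
  qed
  also have "\<dots> = (\<integral>\<^sup>+u. \<integral>\<^sup>+v. f (u, v) \<partial>std_normal_measure \<partial>std_normal_measure)"
    by (subst nn_integral_std_normal2) measurable
  finally show ?thesis .
qed

text \<open>The angle is given by its cosine \<open>k\<close> and sine \<open>l\<close>. At the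
  origin it is arbitrary, and including that case spares the Gaussian induction a division by a
  radius that may be 0.\<close>

lemma polar_coordinates_ex:
  "\<exists>k l :: real. k\<^sup>2 + l\<^sup>2 = 1 \<and> a = sqrt (a\<^sup>2 + p\<^sup>2) * k \<and> p = sqrt (a\<^sup>2 + p\<^sup>2) * l"
proof (cases "a = 0 \<and> p = 0")
  case True
  then show ?thesis by (intro exI[of _ 1] exI[of _ 0]) simp
next
  case False
  then have pos: "a\<^sup>2 + p\<^sup>2 > 0" by (simp add: sum_power2_gt_zero_iff)
  let ?s = "sqrt (a\<^sup>2 + p\<^sup>2)"
  have "(a / ?s)\<^sup>2 + (p / ?s)\<^sup>2 = (a\<^sup>2 + p\<^sup>2) / ?s\<^sup>2"
    by (simp only: power_divide add_divide_distrib)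
  also have "\<dots> = 1" using False pos by simp
  finally show ?thesis using False
    by (intro exI[of _ "a / ?s"] exI[of _ "p / ?s"]) auto
qed

text \<open>
  A pair of linear forms of a Gaussian vector has the law of \<open>(a u, b u + c v)\<close> with \<open>u\<close>, \<open>v\<close>
  independent standard normal, the triangular matrix being the Cholesky factor of its covariance.
  In the induction step a third normal variable is merged by two plane rotations.
\<close>

lemma std_gaussian_two_forms:
  "\<exists>a b c. 0 \<le> a \<and> 0 \<le> c \<and> a\<^sup>2 = dotp d x x \<and> a * b = dotp d x y \<and> b\<^sup>2 + c\<^sup>2 = dotp d y y \<and>
     (\<forall>f :: real \<times> real \<Rightarrow> ennreal. f \<in> borel_measurable (borel \<Otimes>\<^sub>M borel) \<longrightarrow>
       (\<integral>\<^sup>+r. f (dotp d x r, dotp d y r) \<partial>std_gaussian d) =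
       (\<integral>\<^sup>+u. \<integral>\<^sup>+v. f (a * u, b * u + c * v) \<partial>std_normal_measure \<partial>std_normal_measure))"
proof (induction d)
  case 0
  interpret prob_space std_normal_measure by (rule prob_space_std_normal)
  have "emeasure std_normal_measure UNIV = 1" using emeasure_space_1 by simp
  moreover have "emeasure (std_gaussian 0) (space (std_gaussian 0)) = 1"
    by (rule prob_space.emeasure_space_1[OF prob_space_std_gaussian])
  ultimately show ?case
    by (intro exI[of _ 0]) (simp add: dotp_def)
next
  case (Suc d)
  interpret prob_space std_normal_measure by (rule prob_space_std_normal)
  let ?N = std_normal_measure
  have N_UNIV [simp]: "emeasure ?N UNIV = 1" using emeasure_space_1 by simp
  from Suc.IH obtain a b c where abc: "0 \<le> a" "0 \<le> c" "a\<^sup>2 = dotp d x x" "a * b = dotp d x y"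
      "b\<^sup>2 + c\<^sup>2 = dotp d y y"
    and IH': "\<forall>f :: real \<times> real \<Rightarrow> ennreal. f \<in> borel_measurable (borel \<Otimes>\<^sub>M borel) \<longrightarrow>
       (\<integral>\<^sup>+r. f (dotp d x r, dotp d y r) \<partial>std_gaussian d) =
       (\<integral>\<^sup>+u. \<integral>\<^sup>+v. f (a * u, b * u + c * v) \<partial>?N \<partial>?N)"
    by (elim exE conjE)
  note IH = IH'[rule_format]
  define p q where "p = x d" and "q = y d"
  define a' where "a' = sqrt (a\<^sup>2 + p\<^sup>2)"
  from polar_coordinates_ex[of a p, folded a'_def] obtain k l where
    kl: "k\<^sup>2 + l\<^sup>2 = 1" "a = a' * k" "p = a' * l" by blast
  define \<beta> \<delta> where "\<beta> = b * k + q * l" and "\<delta> = q * k - b * l"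
  define c' where "c' = sqrt (\<delta>\<^sup>2 + c\<^sup>2)"
  from polar_coordinates_ex[of \<delta> c, folded c'_def] obtain k' l' where
    kl': "k'\<^sup>2 + l'\<^sup>2 = 1" "\<delta> = c' * k'" "c = c' * l'" by blast
  have dot: "dotp (Suc d) z (r(d := t)) = dotp d z r + z d * t" for z r t
    by (auto simp: dotp_def intro!: sum.cong)
  have dotS: "dotp (Suc d) z z' = dotp d z z' + z d * z' d" for z z'
    by (simp add: dotp_def)
  show ?case
  proof (intro exI conjI allI impI)
    show "0 \<le> a'" "0 \<le> c'" by (simp_all add: a'_def c'_def)
    have "a'\<^sup>2 = a\<^sup>2 + p\<^sup>2" by (simp add: a'_def)
    then show "a'\<^sup>2 = dotp (Suc d) x x"
      using abc by (simp add: dotS p_def power2_eq_square)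
    have "a' * \<beta> = a * b + p * q" unfolding \<beta>_def kl(2,3) by (simp add: algebra_simps)
    then show "a' * \<beta> = dotp (Suc d) x y" using abc by (simp add: dotS p_def q_def)
    have "\<beta>\<^sup>2 + \<delta>\<^sup>2 = (k\<^sup>2 + l\<^sup>2) * (b\<^sup>2 + q\<^sup>2)"
      by (simp add: \<beta>_def \<delta>_def power2_eq_square algebra_simps)
    then have "\<beta>\<^sup>2 + c'\<^sup>2 = b\<^sup>2 + q\<^sup>2 + c\<^sup>2" using kl by (simp add: c'_def)
    then show "\<beta>\<^sup>2 + c'\<^sup>2 = dotp (Suc d) y y"
      using abc by (simp add: dotS q_def power2_eq_square)
  next
    fix f :: "real \<times> real \<Rightarrow> ennreal"
    assume f [measurable]: "f \<in> borel_measurable (borel \<Otimes>\<^sub>M borel)"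
    have dotm [measurable]: "(\<lambda>r. dotp e z r) \<in> borel_measurable (Pi\<^sub>M {..<e} (\<lambda>_. ?N))" for e z
      unfolding dotp_def by measurable
    have psf: "product_sigma_finite (\<lambda>_ :: nat. ?N)"
      by (simp add: product_sigma_finite_def sigma_finite_std_normal)
    have sg: "std_gaussian e = Pi\<^sub>M {..<e} (\<lambda>_. ?N)" for e
      by (simp add: std_gaussian_def std_normal_measure_def)
    have "(\<integral>\<^sup>+r. f (dotp (Suc d) x r, dotp (Suc d) y r) \<partial>std_gaussian (Suc d)) =
      (\<integral>\<^sup>+r. \<integral>\<^sup>+z. f (dotp (Suc d) x (r(d := z)), dotp (Suc d) y (r(d := z))) \<partial>?N
        \<partial>std_gaussian d)"
      unfolding sg lessThan_Suc
      by (intro product_sigma_finite.product_nn_integral_insert[OF psf])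
        (simp_all add: lessThan_Suc[symmetric])
    also have "\<dots> = (\<integral>\<^sup>+r. \<integral>\<^sup>+z. f (dotp d x r + p * z, dotp d y r + q * z) \<partial>?N \<partial>std_gaussian d)"
      by (simp only: dot p_def q_def)
    also have "\<dots> = (\<integral>\<^sup>+u. \<integral>\<^sup>+v. \<integral>\<^sup>+z. f (a * u + p * z, b * u + c * v + q * z) \<partial>?N \<partial>?N \<partial>?N)"
      using IH[of "\<lambda>(X, Y). \<integral>\<^sup>+z. f (X + p * z, Y + q * z) \<partial>?N"] by simp
    also have "\<dots> = (\<integral>\<^sup>+u. \<integral>\<^sup>+z. \<integral>\<^sup>+v. f (a * u + p * z, b * u + c * v + q * z) \<partial>?N \<partial>?N \<partial>?N)"
    proof (rule nn_integral_cong)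
      fix u
      show "(\<integral>\<^sup>+v. \<integral>\<^sup>+z. f (a * u + p * z, b * u + c * v + q * z) \<partial>?N \<partial>?N) =
        (\<integral>\<^sup>+z. \<integral>\<^sup>+v. f (a * u + p * z, b * u + c * v + q * z) \<partial>?N \<partial>?N)"
        using Fubini_std_normal[of "\<lambda>(v, z). f (a * u + p * z, b * u + c * v + q * z)"] by simp
    qed
    \<comment> \<open>Rotating the \<open>(u, z)\<close> plane by the angle of \<open>(a, p)\<close>
      leaves the first form depending on \<open>u\<close> alone; in the second form the coefficients
      \<open>(b, q)\<close> become \<open>(\<beta>, \<delta>)\<close>.\<close>
    also have "\<dots> = (\<integral>\<^sup>+u. \<integral>\<^sup>+z. \<integral>\<^sup>+v. f (a' * u, \<beta> * u + \<delta> * z + c * v) \<partial>?N \<partial>?N \<partial>?N)"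
    proof -
      have e: "\<beta> * (k * u + l * z) + \<delta> * (k * z - l * u) = b * u + q * z" for u z
      proof -
        have "\<beta> * (k * u + l * z) + \<delta> * (k * z - l * u) = (k\<^sup>2 + l\<^sup>2) * (b * u + q * z)"
          by (simp add: \<beta>_def \<delta>_def power2_eq_square algebra_simps)
        then show ?thesis using kl by simp
      qed
      have e': "a' * (k * u + l * z) = a * u + p * z" for u z
        unfolding kl(2,3) by (simp add: algebra_simps)
      show ?thesis
        using std_normal_rotate[OF kl(1), of "\<lambda>(u, z). \<integral>\<^sup>+v. f (a' * u, \<beta> * u + \<delta> * z + c * v) \<partial>?N"]
        by (simp add: e e' add_ac)
    qed
    \<comment> \<open>For fixed \<open>u\<close> only \<open>\<delta> * z + c * v\<close> matters.
      Rotating the \<open>(z, v)\<close> plane turns it into \<open>c'\<close> times one coordinate,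
      and the other coordinate integrates to the total mass 1.\<close>
    also have "\<dots> = (\<integral>\<^sup>+u. \<integral>\<^sup>+v. f (a' * u, \<beta> * u + c' * v) \<partial>?N \<partial>?N)"
    proof (rule nn_integral_cong)
      fix u
      have e: "c' * (k' * z + l' * v) = \<delta> * z + c * v" for z v
        unfolding kl'(2,3) by (simp add: algebra_simps)
      show "(\<integral>\<^sup>+z. \<integral>\<^sup>+v. f (a' * u, \<beta> * u + \<delta> * z + c * v) \<partial>?N \<partial>?N) =
        (\<integral>\<^sup>+v. f (a' * u, \<beta> * u + c' * v) \<partial>?N)"
        using std_normal_rotate[OF kl'(1), of "\<lambda>(z, v). f (a' * u, \<beta> * u + c' * z)"]
        by (simp add: e add_ac)
    qed
    finally show "(\<integral>\<^sup>+r. f (dotp (Suc d) x r, dotp (Suc d) y r) \<partial>std_gaussian (Suc d)) =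
      (\<integral>\<^sup>+u. \<integral>\<^sup>+v. f (a' * u, \<beta> * u + c' * v) \<partial>?N \<partial>?N)" .
  qed
qed

section \<open>Probability that a random hyperplane separates two unit vectors\<close>

lemma gaussian_wedge:
  "(\<integral>\<^sup>+u. \<integral>\<^sup>+v. indicator {(u, v). 0 < u \<and> k * u < v} (u, v) \<partial>std_normal_measure \<partial>std_normal_measure)
     = ennreal ((pi / 2 - arctan k) / (2 * pi))"
proof -
  let ?g = std_normal_density
  have "(\<integral>\<^sup>+u. \<integral>\<^sup>+v. indicator {(u, v). 0 < u \<and> k * u < v} (u, v) \<partial>std_normal_measure \<partial>std_normal_measure)
    = (\<integral>\<^sup>+u. \<integral>\<^sup>+v. ennreal (?g u * ?g v) * indicator {(u, v). 0 < u \<and> k * u < v} (u, v) \<partial>lborel \<partial>lborel)"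
    by (subst nn_integral_std_normal2) measurable
  \<comment> \<open>Substitute \<open>v = u * s\<close> with \<open>s\<close> the slope: the wedge
    becomes \<open>k < s\<close>, and the factor \<open>u\<close> makes the integral over
    \<open>u\<close> elementary. It equals \<open>1 / (2 * pi * (1 + s\<^sup>2))\<close>, the
    derivative of \<open>arctan s / (2 * pi)\<close>.\<close>
  also have "\<dots> = (\<integral>\<^sup>+u. \<integral>\<^sup>+s. ennreal (u / (2 * pi) * exp (- (1 + s\<^sup>2) * u\<^sup>2 / 2)) * indicator {0..} u *
     indicator {k<..} s \<partial>lborel \<partial>lborel)"
  proof (rule nn_integral_cong)
    fix u :: real
    have g: "u * (?g u * ?g (u * s)) = u / (2 * pi) * exp (- (1 + s\<^sup>2) * u\<^sup>2 / 2)" for s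
    proof -
      have "?g u * ?g (u * s) = 1 / (2 * pi) * (exp (- u\<^sup>2 / 2) * exp (- (u * s)\<^sup>2 / 2))"
        by (simp add: std_normal_density_def)
      also have "exp (- u\<^sup>2 / 2) * exp (- (u * s)\<^sup>2 / 2) = exp (- (1 + s\<^sup>2) * u\<^sup>2 / 2)"
        by (simp add: exp_add[symmetric] power_mult_distrib field_simps)
      finally show ?thesis by simp
    qed
    show "(\<integral>\<^sup>+v. ennreal (?g u * ?g v) * indicator {(u, v). 0 < u \<and> k * u < v} (u, v) \<partial>lborel) =
      (\<integral>\<^sup>+s. ennreal (u / (2 * pi) * exp (- (1 + s\<^sup>2) * u\<^sup>2 / 2)) * indicator {0..} u *
     indicator {k<..} s \<partial>lborel)"
    proof (cases "0 < u")
      case True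
      have "(\<integral>\<^sup>+v. ennreal (?g u * ?g v) * indicator {(u, v). 0 < u \<and> k * u < v} (u, v) \<partial>lborel) =
        ennreal \<bar>u\<bar> * (\<integral>\<^sup>+s. ennreal (?g u * ?g (0 + u * s)) * indicator {(u, v). 0 < u \<and> k * u < v} (u, 0 + u * s) \<partial>lborel)"
        using True by (intro nn_integral_real_affine) auto
      also have "\<dots> = (\<integral>\<^sup>+s. ennreal u * (ennreal (?g u * ?g (u * s)) * indicator {(u, v). 0 < u \<and> k * u < v} (u, u * s)) \<partial>lborel)"
        using True by (subst nn_integral_cmult) auto
      also have "\<dots> = (\<integral>\<^sup>+s. ennreal (u * (?g u * ?g (u * s))) * indicator {0..} u * indicator {k<..} s \<partial>lborel)"
        using True
        by (intro nn_integral_cong) (auto simp: ennreal_mult indicator_def mult.commute[of k])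
      also have "\<dots> = (\<integral>\<^sup>+s. ennreal (u / (2 * pi) * exp (- (1 + s\<^sup>2) * u\<^sup>2 / 2)) * indicator {0..} u *
         indicator {k<..} s \<partial>lborel)"
        by (simp only: g)
      finally show ?thesis .
    next
      case False
      then have "ennreal (u / (2 * pi) * exp (- (1 + s\<^sup>2) * u\<^sup>2 / 2)) * indicator {0..} u = 0" for s
        by (auto simp: indicator_def)
      then have "(\<integral>\<^sup>+s. ennreal (u / (2 * pi) * exp (- (1 + s\<^sup>2) * u\<^sup>2 / 2)) * indicator {0..} u *
         indicator {k<..} s \<partial>lborel) = 0"
        by (simp only: mult_zero_left nn_integral_0_iff nn_integral_const)
      moreover have "(\<integral>\<^sup>+v. ennreal (?g u * ?g v) * indicator {(u, v). 0 < u \<and> k * u < v} (u, v) \<partial>lborel) = 0"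
        using False by simp
      ultimately show ?thesis by simp
    qed
  qed
  also have "\<dots> = (\<integral>\<^sup>+s. \<integral>\<^sup>+u. ennreal (u / (2 * pi) * exp (- (1 + s\<^sup>2) * u\<^sup>2 / 2)) * indicator {0..} u *
     indicator {k<..} s \<partial>lborel \<partial>lborel)"
    by (intro Fubini_lborel) measurable
  also have "\<dots> = (\<integral>\<^sup>+s. ennreal (1 / (2 * pi * (1 + s\<^sup>2))) * indicator {k<..} s \<partial>lborel)"
  proof (rule nn_integral_cong)
    fix s :: real
    have s: "0 < 1 + s\<^sup>2" by (simp add: add_pos_nonneg)
    have deriv: "((\<lambda>u. - exp (- q * u\<^sup>2 / 2) / (2 * pi * q)) has_real_derivative
        u / (2 * pi) * exp (- q * u\<^sup>2 / 2)) (at u)" if "0 < q" for q u :: real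
      using that by (auto intro!: derivative_eq_intros)
    let ?F = "\<lambda>u. - exp (- (1 + s\<^sup>2) * u\<^sup>2 / 2) / (2 * pi * (1 + s\<^sup>2))"
    have "(\<integral>\<^sup>+u. ennreal (u / (2 * pi) * exp (- (1 + s\<^sup>2) * u\<^sup>2 / 2)) * indicator {0..} u \<partial>lborel) =
      0 - ?F 0"
    proof (rule nn_integral_FTC_atLeast)
      have "filterlim (\<lambda>u::real. (1 + s\<^sup>2) / 2 * u\<^sup>2) at_top at_top"
        using s by (intro filterlim_tendsto_pos_mult_at_top[OF tendsto_const] filterlim_pow_at_top filterlim_ident) auto
      then have "((\<lambda>u::real. exp (- ((1 + s\<^sup>2) / 2 * u\<^sup>2))) \<longlongrightarrow> 0) at_top"
        by (intro filterlim_compose[OF exp_at_bot] filterlim_compose[OF filterlim_uminus_at_bot_at_top])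
      then have "((\<lambda>u::real. - exp (- ((1 + s\<^sup>2) / 2 * u\<^sup>2)) / (2 * pi * (1 + s\<^sup>2))) \<longlongrightarrow> - 0 / (2 * pi * (1 + s\<^sup>2))) at_top"
        using s by (intro tendsto_intros) auto
      moreover have "- (1 + s\<^sup>2) * u\<^sup>2 / 2 = - ((1 + s\<^sup>2) / 2 * u\<^sup>2)" for u :: real
        by (simp add: field_simps)
      ultimately show "(?F \<longlongrightarrow> 0) at_top" by (simp only: minus_zero div_0)
    next
      fix u :: real
      show "(?F has_real_derivative u / (2 * pi) * exp (- (1 + s\<^sup>2) * u\<^sup>2 / 2)) (at u)"
        by (rule deriv[OF s])
    qed auto
    then show "(\<integral>\<^sup>+u. ennreal (u / (2 * pi) * exp (- (1 + s\<^sup>2) * u\<^sup>2 / 2)) * indicator {0..} u *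
     indicator {k<..} s \<partial>lborel) = ennreal (1 / (2 * pi * (1 + s\<^sup>2))) * indicator {k<..} s"
      by (subst nn_integral_multc) auto
  qed
  \<comment> \<open>The fundamental theorem is applied on a closed half-line; the endpoint is a null
    set.\<close>
  also have "\<dots> = (\<integral>\<^sup>+s. ennreal (1 / (2 * pi * (1 + s\<^sup>2))) * indicator {k..} s \<partial>lborel)"
    by (intro nn_integral_cong_AE eventually_mono[OF AE_lborel_singleton[of k]])
      (auto simp: indicator_def)
  also have "\<dots> = pi / 2 / (2 * pi) - arctan k / (2 * pi)"
  proof (rule nn_integral_FTC_atLeast)
    show "((\<lambda>s. arctan s / (2 * pi)) \<longlongrightarrow> pi / 2 / (2 * pi)) at_top"
      by (rule tendsto_divide[OF tendsto_arctan_at_top tendsto_const]) auto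
    fix s :: real
    show "((\<lambda>s. arctan s / (2 * pi)) has_real_derivative 1 / (2 * pi * (1 + s\<^sup>2))) (at s)"
      by (rule DERIV_cong[OF DERIV_cdivide[OF DERIV_arctan]])
        (simp only: divide_inverse inverse_mult_distrib mult_1_left mult_ac)
    show "0 \<le> 1 / (2 * pi * (1 + s\<^sup>2))" by simp
  qed auto
  finally show ?thesis by (simp add: diff_divide_distrib)
qed

text \<open>With \<open>x = \<theta> - pi / 2\<close> this is
  \<open>0.85 * (1 - cos \<theta>) / 2 \<le> \<theta> / pi\<close>, which compares what an edge at
  angle \<theta> contributes to the semidefinite value with the probability that it is cut. For
  \<open>x < 0\<close> the chord bound \<open>sin x \<le> 2 * x / pi\<close> gives it even with 1 in
  place of 0.85; for \<open>0 \<le> x\<close> a tangent is used.\<close>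

lemma sin_le_affine:
  fixes x :: real
  assumes "- pi / 2 < x" "x < pi / 2"
  shows "0.85 * (1 + sin x) \<le> 1 + 2 * x / pi"
proof -
  have pi: "3.14 \<le> pi" "pi \<le> 3.15"
    using pi_approx by auto
  have conv: "convex_on {0..pi} (\<lambda>x. - sin x)"
    by (rule f''_ge0_imp_convex[where f' = "\<lambda>x. - cos x" and f'' = sin])
      (auto intro!: derivative_eq_intros sin_ge_zero)
  show ?thesis
  proof (cases "0 \<le> x")
    case True
    define r :: real where "r = sqrt 2 / 2"
    have "sqrt 2 \<le> 1.4143" by (rule real_le_lsqrt) (auto simp: power2_eq_square)
    moreover have "1.4142 \<le> sqrt 2" by (rule real_le_rsqrt) (auto simp: power2_eq_square)
    ultimately have r: "0.7071 \<le> r" "r \<le> 0.70715"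
      unfolding r_def by auto
    \<comment> \<open>The ratio of the two sides is worst at \<open>x\<close> about 0.76, so the
      tangent at \<open>pi / 4\<close>, about 0.785, loses little. Below, \<open>0.70715\<close> is
      \<open>sqrt 2 / 2\<close> rounded up and \<open>0.215\<close> is
      \<open>1 - 3.14 / 4\<close>.\<close>
    have "- r * (x - pi / 4) \<le> - sin x - - sin (pi / 4)"
      using assms True
      by (intro convex_on_imp_above_tangent[OF conv])
        (auto intro!: derivative_eq_intros simp: r_def cos_45)
    moreover have "sin (pi / 4) = r" by (simp add: r_def sin_45)
    ultimately have "sin x \<le> r + r * (x - pi / 4)" by simp
    also have "\<dots> = r * (1 + x - pi / 4)" by (simp add: algebra_simps)
    also have "\<dots> \<le> 0.70715 * (1 + x - pi / 4)"
      using r True pi by (intro mult_right_mono) auto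
    also have "\<dots> \<le> 0.70715 * (0.215 + x)" using pi by (intro mult_left_mono) auto
    finally have 1: "0.85 * (1 + sin x) \<le> 0.85 * (1 + 0.70715 * (0.215 + x))" by simp
    define t where "t = x / pi"
    have "t \<ge> x / 3.15" unfolding t_def using True pi by (intro divide_left_mono) auto
    moreover have "x \<le> 1.575" using assms pi by simp
    ultimately have "0.85 * (1 + sin x) \<le> 1 + 2 * t" using 1 True by simp
    then show ?thesis by (simp add: t_def)
  next
    case False
    have "convex_on {0..pi / 2} (\<lambda>x. - sin x)"
      using conv by (rule convex_on_subset) auto
    from convex_onD_Icc'[OF this, of "- x"] have "sin x \<le> 2 * x / pi"
      using False assms by (simp add: field_simps)
    moreover have "0 \<le> 1 + sin x" using sin_ge_minus_one[of x] by linarith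
    then have "0.85 * (1 + sin x) \<le> 1 + sin x" by simp
    ultimately show ?thesis by linarith
  qed
qed

text \<open>The constant 0.85 replaces the optimal Goemans--Williamson constant 0.87856....\<close>

lemma gaussian_separation:
  assumes bc: "b\<^sup>2 + c\<^sup>2 = 1" and c: "0 \<le> c"
  shows "(\<integral>\<^sup>+u. \<integral>\<^sup>+v. indicator {(s, t). (0 \<le> s) \<noteq> (0 \<le> t)} (u, b * u + c * v)
            \<partial>std_normal_measure \<partial>std_normal_measure) \<ge> ennreal (0.85 * ((1 - b) / 2))"
proof (cases "c = 0")
  \<comment> \<open>The two vectors are equal or opposite and the slope \<open>b / c\<close> makes
    no sense. For \<open>b = 1\<close> the bound is 0; for \<open>b = -1\<close> the signs differ
    unless \<open>u = 0\<close>, a null event.\<close>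
  case True
  let ?N = std_normal_measure
  interpret prob_space ?N by (rule prob_space_std_normal)
  from True bc have "b = 1 \<or> b = -1" by (simp add: power2_eq_1_iff)
  then show ?thesis
  proof
    assume b: "b = -1"
    have "AE u in ?N. u \<noteq> 0"
      unfolding std_normal_measure_def
      by (subst AE_density) (auto intro: eventually_mono[OF AE_lborel_singleton[of 0]])
    then have "(\<integral>\<^sup>+u. \<integral>\<^sup>+v. indicator {(s, t). (0 \<le> s) \<noteq> (0 \<le> t)} (u, b * u + c * v) \<partial>?N \<partial>?N) =
      (\<integral>\<^sup>+u. 1 \<partial>?N)"
    proof (rule nn_integral_cong_AE[OF eventually_mono])
      fix u :: real assume "u \<noteq> 0"
      then have "indicator {(s, t). (0 \<le> s) \<noteq> (0 \<le> t)} (u, b * u + c * v) = (1 :: ennreal)" for v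
        by (auto simp: b True indicator_def)
      then show "(\<integral>\<^sup>+v. indicator {(s, t). (0 \<le> s) \<noteq> (0 \<le> t)} (u, b * u + c * v) \<partial>?N) = 1"
        using emeasure_space_1 by simp
    qed
    then show ?thesis using emeasure_space_1 by (simp add: b)
  qed simp
next
  case False
  let ?N = std_normal_measure
  interpret prob_space ?N by (rule prob_space_std_normal)
  from c False have c: "0 < c" by simp
  define k where "k = b / c"
  define I where "I = (\<integral>\<^sup>+u. \<integral>\<^sup>+v. indicator {(u, v). 0 < u \<and> k * u < v} (u, v) \<partial>?N \<partial>?N)"
  have m [measurable]: "(\<lambda>u. \<integral>\<^sup>+v. indicator {(u, v). 0 < u \<and> k * u < v} (u, v) \<partial>?N) \<in> borel_measurable borel"
    by measurable
  have I: "I = ennreal ((pi / 2 - arctan k) / (2 * pi))"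
    unfolding I_def by (rule gaussian_wedge)
  have reflect: "(\<integral>\<^sup>+v. f (- v) \<partial>?N) = (\<integral>\<^sup>+v. f v \<partial>?N)" if "f \<in> borel_measurable borel" for f
    using std_normal_reflect[of "-1" f] that by simp
  \<comment> \<open>The signs of \<open>u\<close> and \<open>b * u + c * v\<close> differ on a
    double wedge. It contains the images of the wedge \<open>0 < u\<close>, \<open>k * u < v\<close>
    under \<open>v \<mapsto> - v\<close> and under \<open>u \<mapsto> - u\<close>; these are
    disjoint and have measure \<open>I\<close> each.\<close>
  have I1: "(\<integral>\<^sup>+u. \<integral>\<^sup>+v. indicator {(u, v). 0 < u \<and> k * u < v} (u, - v) \<partial>?N \<partial>?N) = I"
    unfolding I_def by (intro nn_integral_cong reflect) measurable
  have "(\<integral>\<^sup>+u. \<integral>\<^sup>+v. indicator {(u, v). 0 < u \<and> k * u < v} (- u, v) \<partial>?N \<partial>?N) = I"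
    unfolding I_def
    by (rule reflect[of "\<lambda>u. \<integral>\<^sup>+v. indicator {(u, v). 0 < u \<and> k * u < v} (u, v) \<partial>?N"]) measurable
  then have "I + I = (\<integral>\<^sup>+u. \<integral>\<^sup>+v. indicator {(u, v). 0 < u \<and> k * u < v} (u, - v) \<partial>?N \<partial>?N) +
     (\<integral>\<^sup>+u. \<integral>\<^sup>+v. indicator {(u, v). 0 < u \<and> k * u < v} (- u, v) \<partial>?N \<partial>?N)"
    using I1 by simp
  also have "\<dots> = (\<integral>\<^sup>+u. \<integral>\<^sup>+v. indicator {(u, v). 0 < u \<and> k * u < v} (u, - v) +
      indicator {(u, v). 0 < u \<and> k * u < v} (- u, v) \<partial>?N \<partial>?N)"
  proof -
    have "(\<integral>\<^sup>+v. indicator {(u, v). 0 < u \<and> k * u < v} (u, - v) +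
        indicator {(u, v). 0 < u \<and> k * u < v} (- u, v) \<partial>?N) =
      (\<integral>\<^sup>+v. indicator {(u, v). 0 < u \<and> k * u < v} (u, - v) \<partial>?N) +
      (\<integral>\<^sup>+v. indicator {(u, v). 0 < u \<and> k * u < v} (- u, v) \<partial>?N)" for u :: real
      by (rule nn_integral_add) measurable
    then show ?thesis by (simp only:) (rule nn_integral_add[symmetric], measurable)
  qed
  also have "\<dots> \<le> (\<integral>\<^sup>+u. \<integral>\<^sup>+v. indicator {(s, t). (0 \<le> s) \<noteq> (0 \<le> t)} (u, b * u + c * v) \<partial>?N \<partial>?N)"
  proof (intro nn_integral_mono)
    fix u v :: real
    have "k * u < v \<longleftrightarrow> b * u < c * v" for u v
      using c by (simp add: k_def field_simps)
    then show "indicator {(u, v). 0 < u \<and> k * u < v} (u, - v) +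
      indicator {(u, v). 0 < u \<and> k * u < v} (- u, v) \<le>
      (indicator {(s, t). (0 \<le> s) \<noteq> (0 \<le> t)} (u, b * u + c * v) :: ennreal)"
      by (auto simp: indicator_def)
  qed
  finally have "I + I \<le> (\<integral>\<^sup>+u. \<integral>\<^sup>+v. indicator {(s, t). (0 \<le> s) \<noteq> (0 \<le> t)} (u, b * u + c * v) \<partial>?N \<partial>?N)" .
  moreover have "ennreal (0.85 * ((1 - b) / 2)) \<le> I + I"
  proof -
    have k: "- pi / 2 < - arctan k" "- arctan k < pi / 2"
      using arctan_bounded[of k] by auto
    have "1 + k\<^sup>2 = (b\<^sup>2 + c\<^sup>2) / c\<^sup>2" using c by (simp add: k_def field_simps)
    then have "sqrt (1 + k\<^sup>2) = 1 / c" using c bc by (simp add: real_sqrt_divide)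
    then have "sin (arctan k) = b" using c by (simp add: sin_arctan k_def)
    with sin_le_affine[OF k] have "0.85 * (1 - b) \<le> 1 - 2 * arctan k / pi" by simp
    then have "0.85 * ((1 - b) / 2) \<le> (pi / 2 - arctan k) / (2 * pi) + (pi / 2 - arctan k) / (2 * pi)"
      by (simp add: diff_divide_distrib)
    then show ?thesis
      using k unfolding I by (subst ennreal_plus[symmetric]) (auto intro!: ennreal_leI)
  qed
  ultimately show ?thesis by (rule order_trans[rotated])
qed

lemma std_gaussian_separation:
  assumes x: "dotp d x x = 1" and y: "dotp d y y = 1"
  shows "measure (std_gaussian d) {r \<in> space (std_gaussian d). (0 \<le> dotp d x r) \<noteq> (0 \<le> dotp d y r)}
    \<ge> 0.85 * ((1 - dotp d x y) / 2)"
proof -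
  let ?M = "std_gaussian d" and ?D = "{(s, t). (0 \<le> s) \<noteq> (0 \<le> (t::real))} :: (real \<times> real) set"
  interpret prob_space ?M by (rule prob_space_std_gaussian)
  obtain a b c where abc: "0 \<le> a" "0 \<le> c" "a\<^sup>2 = dotp d x x" "a * b = dotp d x y"
      "b\<^sup>2 + c\<^sup>2 = dotp d y y"
    and f: "\<forall>f :: real \<times> real \<Rightarrow> ennreal. f \<in> borel_measurable (borel \<Otimes>\<^sub>M borel) \<longrightarrow>
       (\<integral>\<^sup>+r. f (dotp d x r, dotp d y r) \<partial>?M) =
       (\<integral>\<^sup>+u. \<integral>\<^sup>+v. f (a * u, b * u + c * v) \<partial>std_normal_measure \<partial>std_normal_measure)"
    using std_gaussian_two_forms[of d x y] by (elim exE conjE)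
  from abc x have a: "a = 1" by (simp add: power2_eq_1_iff)
  have m [measurable]: "(\<lambda>r. dotp d z r) \<in> borel_measurable ?M" for z
    unfolding dotp_def std_gaussian_def by measurable
  let ?E = "{r \<in> space ?M. (0 \<le> dotp d x r) \<noteq> (0 \<le> dotp d y r)}"
  have "ennreal (0.85 * ((1 - b) / 2)) \<le>
     (\<integral>\<^sup>+u. \<integral>\<^sup>+v. indicator ?D (u, b * u + c * v) \<partial>std_normal_measure \<partial>std_normal_measure)"
    using abc y by (intro gaussian_separation) auto
  also have "\<dots> = (\<integral>\<^sup>+r. indicator ?D (dotp d x r, dotp d y r) \<partial>?M)"
    using f[rule_format, of "indicator ?D"] by (simp add: a)
  also have "\<dots> = (\<integral>\<^sup>+r. indicator ?E r \<partial>?M)"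
    by (intro nn_integral_cong) (auto simp: indicator_def)
  also have "\<dots> = ennreal (measure ?M ?E)"
    by (subst nn_integral_indicator) (measurable, simp add: emeasure_eq_measure)
  finally show ?thesis using abc a by simp
qed

section \<open>The semidefinite program\<close>

text \<open>The indicator in \<open>S\<close> lets linearity of expectation turn a random cut
  directly into separation probabilities.\<close>

definition cut_weight :: "(nat \<Rightarrow> nat \<Rightarrow> real) \<Rightarrow> nat set \<Rightarrow> nat set \<Rightarrow> real" where
  "cut_weight w B S = (\<Sum>(i, j)\<in>edges B. w i j * indicator {A. (i \<in> A) \<noteq> (j \<in> A)} S)"

lemma finite_edges [simp]: "finite B \<Longrightarrow> finite (edges B)"
  by (rule finite_subset[of _ "B \<times> B"]) (auto simp: edges_def)

lemma edgesD: "(i, j) \<in> edges B \<Longrightarrow> i \<in> B \<and> j \<in> B \<and> i < j"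
  by (simp add: edges_def)

lemma set_hyperplane_rounding:
  assumes "finite B"
  shows "set_pmf (hyperplane_rounding B x) \<subseteq> Pow B"
proof
  fix S assume "S \<in> set_pmf (hyperplane_rounding B x)"
  then have "measure (std_gaussian (card B))
      {r \<in> space (std_gaussian (card B)). hyperplane_side B x r = S} \<noteq> 0"
    using assms by (simp add: set_pmf_iff pmf_hyperplane_rounding)
  then have "{r \<in> space (std_gaussian (card B)). hyperplane_side B x r = S} \<noteq> {}"
    by (intro notI) (simp only: measure_empty)
  then show "S \<in> Pow B" by (auto simp: hyperplane_side_def)
qed

lemma hyperplane_rounding_separation:
  assumes fin: "finite B" and x: "sdp_feasible B x" and ij: "i \<in> B" "j \<in> B"
  shows "measure_pmf.prob (hyperplane_rounding B x) {A. (i \<in> A) \<noteq> (j \<in> A)}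
    \<ge> 0.85 * ((1 - dotp (card B) (x i) (x j)) / 2)"
proof -
  let ?M = "std_gaussian (card B)" and ?P = "hyperplane_rounding B x"
  let ?S = "{A. A \<subseteq> B \<and> (i \<in> A) \<noteq> (j \<in> A)}"
  let ?E = "\<lambda>S. {r \<in> space ?M. hyperplane_side B x r = S}"
  interpret prob_space ?M by (rule prob_space_std_gaussian)
  have finS: "finite ?S" using fin by simp
  have "measure_pmf.prob ?P {A. (i \<in> A) \<noteq> (j \<in> A)} = measure_pmf.prob ?P ?S"
    using set_hyperplane_rounding[OF fin, of x]
    by (intro measure_pmf.finite_measure_eq_AE) (auto simp: AE_measure_pmf_iff)
  also have "\<dots> = (\<Sum>A\<in>?S. prob (?E A))"
    using finS fin by (simp add: measure_measure_pmf_finite pmf_hyperplane_rounding)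
  also have "\<dots> = prob (\<Union>A\<in>?S. ?E A)"
    using finS hyperplane_side_event[OF fin]
    by (intro finite_measure_finite_Union[symmetric])
      (auto simp: disjoint_family_on_def)
  also have "(\<Union>A\<in>?S. ?E A) =
      {r \<in> space ?M. (0 \<le> dotp (card B) (x i) r) \<noteq> (0 \<le> dotp (card B) (x j) r)}"
    using ij by (auto simp: hyperplane_side_def)
  finally show ?thesis
    using std_gaussian_separation[of "card B" "x i" "x j"] x ij by (simp add: sdp_feasible_def)
qed

lemma expected_cut_weight:
  assumes fin: "finite B" and x: "sdp_feasible B x"
    and w: "\<And>i j. i \<in> B \<Longrightarrow> j \<in> B \<Longrightarrow> 0 \<le> w i j"
  shows "measure_pmf.expectation (hyperplane_rounding B x) (cut_weight w B) \<ge> 0.85 * sdp_value w B x"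
proof -
  let ?P = "hyperplane_rounding B x"
  have finP: "finite (set_pmf ?P)"
    using set_hyperplane_rounding[OF fin] fin by (meson finite_Pow_iff finite_subset)
  have "0.85 * sdp_value w B x =
      (\<Sum>(i, j)\<in>edges B. w i j * (0.85 * ((1 - dotp (card B) (x i) (x j)) / 2)))"
    unfolding sdp_value_def sum_distrib_left by (intro sum.cong) auto
  also have "\<dots> \<le> (\<Sum>(i, j)\<in>edges B. w i j * measure_pmf.prob ?P {A. (i \<in> A) \<noteq> (j \<in> A)})"
  proof (rule sum_mono, clarify)
    fix i j assume "(i, j) \<in> edges B"
    then have ij: "i \<in> B" "j \<in> B" by (auto dest: edgesD)
    show "w i j * (0.85 * ((1 - dotp (card B) (x i) (x j)) / 2)) \<le>
      w i j * measure_pmf.prob ?P {A. (i \<in> A) \<noteq> (j \<in> A)}"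
      by (intro mult_left_mono hyperplane_rounding_separation[OF fin x] w ij)
  qed
  also have "\<dots> = measure_pmf.expectation ?P (cut_weight w B)"
    unfolding cut_weight_def
    by (subst Bochner_Integration.integral_sum)
      (auto intro!: sum.cong integrable_measure_pmf_finite finP)
  finally show ?thesis .
qed

lemma dotp_cong: "(\<And>k. k < d \<Longrightarrow> x k = x' k) \<Longrightarrow> (\<And>k. k < d \<Longrightarrow> y k = y' k) \<Longrightarrow> dotp d x y = dotp d x' y'"
  by (simp add: dotp_def)

text \<open>Coordinates from \<open>card B\<close> on and vectors of vertices outside
  \<open>B\<close> are unconstrained, so the feasible set itself is not compact. The maximum is
  taken over its part \<open>K\<close> inside a product of intervals, compact by Tychonoff; a
  feasible \<open>y\<close> is moved into \<open>K\<close> by resetting the free coordinates, which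
  does not change its value.\<close>

lemma ex_sdp_optimal:
  assumes fin: "finite B"
  shows "\<exists>x. sdp_optimal w B x"
proof (cases "B = {}")
  case True
  then show ?thesis by (auto simp: sdp_optimal_def sdp_feasible_def sdp_value_def edges_def)
next
  case False
  with fin have d: "0 < card B" by (simp add: card_gt_0_iff)
  define box where "box = (\<Pi>\<^sub>E i\<in>(UNIV :: nat set). \<Pi>\<^sub>E k\<in>(UNIV :: nat set). {- 1..1 :: real})"
  define K where "K = {x \<in> box. sdp_feasible B x}"
  have "compactin (product_topology (\<lambda>_. euclidean) (UNIV :: nat set))
      (\<Pi>\<^sub>E k\<in>(UNIV :: nat set). {- 1..1 :: real})"
    by (subst compactin_PiE) auto
  then have "compactin (product_topology (\<lambda>_. euclidean) (UNIV :: nat set)) box"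
    unfolding box_def by (subst compactin_PiE) (auto simp: euclidean_product_topology)
  then have box: "compact box" by (simp add: euclidean_product_topology)
  have coord: "continuous_on UNIV (\<lambda>x :: nat \<Rightarrow> nat \<Rightarrow> real. x i k)" for i k
    by (intro continuous_on_compose2[OF continuous_on_product_coordinates continuous_on_product_coordinates])
      auto
  have dot: "continuous_on UNIV (\<lambda>x :: nat \<Rightarrow> nat \<Rightarrow> real. dotp e (x i) (x j))" for e i j
    unfolding dotp_def by (intro continuous_intros coord)
  have "closed {x. sdp_feasible B x}"
    unfolding sdp_feasible_def Ball_def
    by (intro closed_Collect_all closed_Collect_imp closed_Collect_eq dot continuous_on_const) auto
  with box have "compact K"
    unfolding K_def by (metis Collect_conj_eq Collect_mem_eq compact_Int_closed)
  moreover have "(\<lambda>i k. if k = 0 then 1 else 0) \<in> K"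
    using d by (auto simp: K_def box_def sdp_feasible_def dotp_def if_distrib cong: if_cong)
  then have "K \<noteq> {}" by blast
  moreover have "continuous_on K (sdp_value w B)"
    unfolding sdp_value_def case_prod_beta
    by (intro continuous_intros continuous_on_subset[OF dot]) auto
  ultimately obtain x where x: "x \<in> K" "\<And>y. y \<in> K \<Longrightarrow> sdp_value w B y \<le> sdp_value w B x"
    using continuous_attains_sup[of K "sdp_value w B"] by metis
  have "sdp_value w B y \<le> sdp_value w B x" if y: "sdp_feasible B y" for y
  proof -
    define y' where "y' i k = (if i \<in> B then if k < card B then y i k else 0 else if k = 0 then 1 else 0)" for i k
    have dot: "dotp (card B) (y' i) (y' j) = dotp (card B) (y i) (y j)" if "i \<in> B" "j \<in> B" for i j
      using that by (intro dotp_cong) (auto simp: y'_def)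
    have "\<bar>y' i k\<bar> \<le> 1" for i k
    proof (cases "i \<in> B \<and> k < card B")
      case True
      then have "(y i k)\<^sup>2 \<le> (\<Sum>k<card B. (y i k)\<^sup>2)"
        by (intro member_le_sum) auto
      also have "\<dots> = 1" using y True by (simp add: sdp_feasible_def dotp_def power2_eq_square)
      finally have "\<bar>y i k\<bar> \<le> 1" by (simp add: abs_square_le_1)
      with True show ?thesis by (simp add: y'_def)
    qed (auto simp: y'_def)
    then have "- 1 \<le> y' i k \<and> y' i k \<le> 1" for i k by (simp add: abs_le_iff minus_le_iff)
    then have "y' \<in> K"
      using y by (auto simp: K_def box_def sdp_feasible_def dot)
    moreover have "sdp_value w B y' = sdp_value w B y"
      unfolding sdp_value_def by (intro sum.cong) (auto dest!: edgesD simp: dot)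
    ultimately show ?thesis using x by force
  qed
  with x show ?thesis by (auto simp: sdp_optimal_def K_def)
qed

text \<open>Pairwise orthogonal unit vectors give every edge the factor 1/2. Dimension
  \<open>card B\<close> has just enough room for them; \<open>h\<close> assigns the axes to the
  vertices.\<close>

lemma sdp_optimal_ge_half:
  assumes fin: "finite B" and opt: "sdp_optimal w B x"
  shows "sdp_value w B x \<ge> total_weight w B / 2"
proof -
  obtain h where h: "bij_betw h B {..<card B}"
    using ex_bij_betw_finite_nat[OF fin] by (auto simp: atLeast0LessThan)
  define y where "y i k = (if k = h i then 1 else 0 :: real)" for i k
  have dot: "dotp (card B) (y i) (y j) = (if i = j then 1 else 0)" if "i \<in> B" "j \<in> B" for i j
  proof -
    have "dotp (card B) (y i) (y j) = (\<Sum>k<card B. if k = h i then if h i = h j then 1 else 0 else 0)"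
      unfolding dotp_def y_def by (intro sum.cong) auto
    also have "\<dots> = (if h i = h j then 1 else 0)"
      using that h bij_betwE by fastforce
    also have "h i = h j \<longleftrightarrow> i = j"
      using that h by (auto simp: bij_betw_def inj_on_def)
    finally show ?thesis .
  qed
  have "sdp_feasible B y" by (simp add: sdp_feasible_def dot)
  moreover have "sdp_value w B y = total_weight w B / 2"
    unfolding sdp_value_def total_weight_def sum_divide_distrib
    by (intro sum.cong) (auto dest!: edgesD simp: dot)
  ultimately show ?thesis using opt by (metis sdp_optimal_def)
qed

text \<open>A cut is the feasible point that puts the vertices at the two ends of a single
  axis.\<close>

lemma sdp_optimal_ge_cut:
  assumes fin: "finite B" and opt: "sdp_optimal w B x"
  shows "sdp_value w B x \<ge> cut_weight w B S"
proof (cases "B = {}")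
  case True
  then show ?thesis by (simp add: sdp_value_def cut_weight_def edges_def)
next
  case False
  with fin have d: "0 < card B" by (simp add: card_gt_0_iff)
  define y where "y i k = (if k = 0 then if i \<in> S then 1 else - 1 else 0 :: real)" for i k :: nat
  have dot: "dotp (card B) (y i) (y j) = (if (i \<in> S) = (j \<in> S) then 1 else - 1)" for i j
  proof -
    have "dotp (card B) (y i) (y j) =
        (\<Sum>k<card B. if k = 0 then if (i \<in> S) = (j \<in> S) then 1 else - 1 else 0)"
      unfolding dotp_def y_def by (intro sum.cong) auto
    then show ?thesis using d by simp
  qed
  have "sdp_feasible B y" by (simp add: sdp_feasible_def dot)
  moreover have "sdp_value w B y = cut_weight w B S"
    unfolding sdp_value_def cut_weight_def by (intro sum.cong) (auto simp: dot)
  ultimately show ?thesis using opt by (metis sdp_optimal_def)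
qed

lemma sdp_value_le_total:
  assumes x: "sdp_feasible B x" and w: "\<And>i j. i \<in> B \<Longrightarrow> j \<in> B \<Longrightarrow> 0 \<le> w i j"
  shows "sdp_value w B x \<le> total_weight w B"
proof -
  have dot: "- 1 \<le> dotp (card B) (x i) (x j)" if "i \<in> B" "j \<in> B" for i j
  proof -
    have "0 \<le> dotp (card B) (\<lambda>k. x i k + x j k) (\<lambda>k. x i k + x j k)"
      by (simp add: dotp_def sum_nonneg)
    also have "\<dots> = dotp (card B) (x i) (x i) + 2 * dotp (card B) (x i) (x j) + dotp (card B) (x j) (x j)"
      by (simp add: dotp_def sum.distrib[symmetric] sum_distrib_left algebra_simps)
    finally show ?thesis using x that by (simp add: sdp_feasible_def)
  qed
  show ?thesis
    unfolding sdp_value_def total_weight_def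
  proof (rule sum_mono, clarify)
    fix i j assume "(i, j) \<in> edges B"
    then have ij: "i \<in> B" "j \<in> B" by (auto dest: edgesD)
    show "w i j * ((1 - dotp (card B) (x i) (x j)) / 2) \<le> w i j"
      using dot[OF ij] w[OF ij] by (intro mult_left_le) auto
  qed
qed

section \<open>Revenue of Random Partitioning\<close>

definition crossing :: "nat set \<Rightarrow> nat set \<Rightarrow> (nat \<times> nat) set" where
  "crossing V A = {(i, j) \<in> edges V. (i \<in> A) \<noteq> (j \<in> A)}"

text \<open>Only pairs inside \<open>B\<close> are counted, but cluster sizes are taken in all of
  \<open>T\<close>. An optimal tree on all items can thus be evaluated on the edges that survive the
  peeling.\<close>

definition revenue :: "(nat \<Rightarrow> nat \<Rightarrow> real) \<Rightarrow> nat set \<Rightarrow> nat htree \<Rightarrow> real" where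
  "revenue w B T = (\<Sum>(i, j)\<in>edges B. w i j * real (card (leaves (lca_subtree i j T))))"

lemma Rev_eq_revenue: "Rev n w = revenue w {..<n}"
  by (simp add: fun_eq_iff Rev_def revenue_def)

lemma cut_weight_eq_sum_crossing:
  assumes "finite B"
  shows "cut_weight w B S = (\<Sum>(i, j)\<in>crossing B S. w i j)"
  unfolding cut_weight_def crossing_def
  using assms by (subst sum.mono_neutral_cong_right[of "edges B" "{(i, j) \<in> edges B. (i \<in> S) \<noteq> (j \<in> S)}"])
    (auto simp: indicator_def split: if_splits)

lemma sum_edges_split:
  assumes "finite V" "A \<subseteq> V"
  shows "sum f (edges V) = sum f (edges A) + sum f (edges (V - A)) + sum f (crossing V A)"
proof -
  have e: "edges V = edges A \<union> edges (V - A) \<union> crossing V A"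
    using assms by (auto simp: edges_def crossing_def)
  have fin: "finite (edges A)" "finite (edges (V - A))" "finite (crossing V A)"
    using assms finite_subset[OF assms(2,1)] finite_subset[of "crossing V A" "edges V"]
    by (auto simp: crossing_def)
  show ?thesis unfolding e
    using fin by (subst sum.union_disjoint; (subst sum.union_disjoint)?)
      (auto simp: edges_def crossing_def)
qed

lemma total_weight_split:
  assumes "finite V" "A \<subseteq> V"
  shows "total_weight w V = total_weight w A + total_weight w (V - A) + cut_weight w V A"
  unfolding total_weight_def cut_weight_eq_sum_crossing[OF assms(1)]
  by (rule sum_edges_split[OF assms])

lemma finite_leaves [simp]: "finite (leaves T)"
  by (induction T) auto

lemma leaves_nonempty [simp]: "leaves T \<noteq> {}"
  by (induction T) auto

lemma revenue_Node:
  assumes B: "B \<subseteq> leaves (Node l r)" and disj: "leaves l \<inter> leaves r = {}"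
  shows "revenue w B (Node l r) = revenue w (B \<inter> leaves l) l + revenue w (B \<inter> leaves r) r +
    cut_weight w B (leaves l) * card (leaves (Node l r))"
proof -
  have fin: "finite B" using B finite_leaves by (rule finite_subset)
  have BA: "B - B \<inter> leaves l = B \<inter> leaves r" using B disj by auto
  have cross: "crossing B (B \<inter> leaves l) = crossing B (leaves l)"
    by (auto simp: crossing_def edges_def)
  have "revenue w B (Node l r) =
     (\<Sum>(i, j)\<in>edges (B \<inter> leaves l). w i j * real (card (leaves (lca_subtree i j (Node l r))))) +
     (\<Sum>(i, j)\<in>edges (B \<inter> leaves r). w i j * real (card (leaves (lca_subtree i j (Node l r))))) +
     (\<Sum>(i, j)\<in>crossing B (leaves l). w i j * real (card (leaves (lca_subtree i j (Node l r)))))"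
    unfolding revenue_def using sum_edges_split[OF fin, of "B \<inter> leaves l"] by (simp add: BA cross)
  also have "(\<Sum>(i, j)\<in>edges (B \<inter> leaves l). w i j * real (card (leaves (lca_subtree i j (Node l r))))) =
      revenue w (B \<inter> leaves l) l"
    unfolding revenue_def by (intro sum.cong) (auto dest!: edgesD)
  also have "(\<Sum>(i, j)\<in>edges (B \<inter> leaves r). w i j * real (card (leaves (lca_subtree i j (Node l r))))) =
      revenue w (B \<inter> leaves r) r"
    unfolding revenue_def using disj by (intro sum.cong) (auto dest!: edgesD)
  also have "(\<Sum>(i, j)\<in>crossing B (leaves l). w i j * real (card (leaves (lca_subtree i j (Node l r))))) =
      (\<Sum>(i, j)\<in>crossing B (leaves l). w i j * card (leaves (Node l r)))"
  proof (intro sum.cong refl, clarify)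
    fix i j assume "(i, j) \<in> crossing B (leaves l)"
    then have "\<not> {i, j} \<subseteq> leaves l" "\<not> {i, j} \<subseteq> leaves r"
      using disj by (auto simp: crossing_def)
    then show "w i j * real (card (leaves (lca_subtree i j (Node l r)))) =
      w i j * card (leaves (Node l r))" by (simp only: lca_subtree.simps if_False)
  qed
  also have "\<dots> = cut_weight w B (leaves l) * card (leaves (Node l r))"
    unfolding cut_weight_eq_sum_crossing[OF fin] sum_distrib_right by (simp add: case_prod_beta)
  finally show ?thesis .
qed

lemma card_leaves_lca_le: "card (leaves (lca_subtree i j T)) \<le> card (leaves T)"
proof (induction T)
  case (Node l r)
  have "card (leaves l) \<le> card (leaves (Node l r))" "card (leaves r) \<le> card (leaves (Node l r))"
    by (auto intro!: card_mono)
  with Node.IH show ?case by auto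
qed simp

section \<open>Exact expected cluster sizes under Random Partitioning\<close>

lemma sum_Pow_insert:
  assumes "finite X" "a \<notin> X"
  shows "sum g (Pow (insert a X)) = (\<Sum>A\<in>Pow X. g A + g (insert a A))"
proof -
  have "sum g (Pow (insert a X)) = sum g (Pow X) + sum g (insert a ` Pow X)"
    unfolding Pow_insert using assms by (intro sum.union_disjoint) auto
  also have "sum g (insert a ` Pow X) = (\<Sum>A\<in>Pow X. g (insert a A))"
    using assms by (subst sum.reindex) (auto simp: inj_on_def)
  finally show ?thesis by (simp add: sum.distrib)
qed

abbreviation bipartitions :: "nat set \<Rightarrow> nat set set" where
  "bipartitions V \<equiv> {A. A \<subseteq> V \<and> A \<noteq> {} \<and> A \<noteq> V}"

lemma random_partitioning_clustering_tree:
  assumes "finite V" "V \<noteq> {}" "T \<in> set_pmf (random_partitioning V)"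
  shows "clustering_tree V T"
  using assms
proof (induction V arbitrary: T rule: finite_psubset_induct)
  case (psubset V)
  show ?case
  proof (cases "card V < 2")
    case True
    with psubset.prems(1) psubset.hyps have "card V = 1"
      using card_gt_0_iff[of V] by linarith
    then obtain x where "V = {x}" by (auto simp: card_1_singleton_iff)
    with psubset.prems True show ?thesis
      by (simp add: random_partitioning.simps[of "{x}"] clustering_tree_def)
  next
    case False
    with psubset.prems obtain A l r where A: "A \<in> bipartitions V"
      and l: "l \<in> set_pmf (random_partitioning A)" and r: "r \<in> set_pmf (random_partitioning (V - A))"
      and T: "T = Node l r"
      by (subst (asm) random_partitioning.simps) (auto simp: set_pmf_bipartition[OF False])
    have "clustering_tree A l" "clustering_tree (V - A) r"
      using A l r by (auto intro!: psubset.IH)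
    with A T show ?thesis by (auto simp: clustering_tree_def)
  qed
qed

lemma finite_set_random_partitioning:
  assumes "finite V" "V \<noteq> {}"
  shows "finite (set_pmf (random_partitioning V))"
  using random_partitioning_clustering_tree[OF assms] finite_clustering_trees[OF assms(1)]
  by (metis (mono_tags, lifting) finite_subset mem_Collect_eq subsetI)

lemma expectation_cong_map_pmf:
  "map_pmf f p = map_pmf g q \<Longrightarrow> measure_pmf.expectation p f = measure_pmf.expectation q (g :: _ \<Rightarrow> real)"
  by (metis integral_map_pmf[of _ _ "\<lambda>x. x"])

text \<open>The value solves exactly the recursion obtained by conditioning on the first split:
  either \<open>i\<close> and \<open>j\<close> are separated, at size \<open>card V\<close>, or both
  lie in one part and the induction hypothesis applies to it.\<close>

lemma expected_lca_size:
  assumes "finite V" "i \<in> V" "j \<in> V" "i \<noteq> j"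
  shows "measure_pmf.expectation (random_partitioning V)
      (\<lambda>T. real (card (leaves (lca_subtree i j T)))) = 2 / 3 * (real (card V) + 1)"
  using assms
proof (induction V rule: finite_psubset_induct)
  case (psubset V)
  let ?h = "\<lambda>T. real (card (leaves (lca_subtree i j T)))"
  let ?m = "card V"
  have "card {i, j} \<le> ?m" using psubset.prems psubset.hyps by (intro card_mono) auto
  then have m: "2 \<le> ?m" using psubset.prems by simp
  have ne: "V \<noteq> {}" using psubset.prems by auto
  define f where "f k = 2 / 3 * (real k + 1)" for k
  define g where "g A = (if i \<in> A \<and> j \<in> A then f (card A)
    else if i \<notin> A \<and> j \<notin> A then f (card (V - A)) else real ?m)" for A
  have finP: "finite (bipartitions V)" using psubset.hyps by simp
  have iP: "{i} \<in> bipartitions V" using psubset.prems by auto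
  have "measure_pmf.expectation (random_partitioning V) ?h =
    (\<Sum>A\<in>bipartitions V. measure_pmf.expectation (bind_pmf (random_partitioning A) (\<lambda>l.
           bind_pmf (random_partitioning (V - A)) (\<lambda>r. return_pmf (Node l r)))) ?h /
        real (card (bipartitions V)))"
  proof -
    let ?F = "\<lambda>A. bind_pmf (random_partitioning A) (\<lambda>l.
           bind_pmf (random_partitioning (V - A)) (\<lambda>r. return_pmf (Node l r)))"
    have "finite (set_pmf (?F A))" if "A \<in> bipartitions V" for A
    proof -
      have "finite A" "A \<noteq> {}" "finite (V - A)" "V - A \<noteq> {}"
        using psubset.hyps that by (auto intro: finite_subset)
      then show ?thesis by (simp add: finite_set_random_partitioning)
    qed
    then have "measure_pmf.expectation (bind_pmf (pmf_of_set (bipartitions V)) ?F) ?h =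
        (\<Sum>A\<in>bipartitions V. measure_pmf.expectation (?F A) ?h /\<^sub>R real (card (bipartitions V)))"
      using iP finP by (intro pmf_expectation_bind_pmf_of_set) blast+
    moreover have "random_partitioning V = bind_pmf (pmf_of_set (bipartitions V)) ?F"
      using m by (subst random_partitioning.simps) simp
    ultimately show ?thesis by (simp only: real_scaleR_def divide_inverse mult.commute)
  qed
  also have "\<dots> = (\<Sum>A\<in>bipartitions V. g A / real (card (bipartitions V)))"
  proof (rule sum.cong[OF refl])
    fix A assume A: "A \<in> bipartitions V"
    then have fin: "finite A" "A \<noteq> {}" "finite (V - A)" "V - A \<noteq> {}"
      using psubset.hyps by (auto intro: finite_subset)
    note tree = random_partitioning_clustering_tree[OF fin(1,2)]
      random_partitioning_clustering_tree[OF fin(3,4)]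
    let ?p = "bind_pmf (random_partitioning A) (\<lambda>l.
           bind_pmf (random_partitioning (V - A)) (\<lambda>r. return_pmf (Node l r)))"
    have map: "map_pmf ?h ?p = bind_pmf (random_partitioning A) (\<lambda>l.
           bind_pmf (random_partitioning (V - A)) (\<lambda>r. return_pmf (?h (Node l r))))"
      by (simp add: map_bind_pmf)
    consider "i \<in> A" "j \<in> A" | "i \<notin> A" "j \<notin> A" | "(i \<in> A) \<noteq> (j \<in> A)" by blast
    then have "measure_pmf.expectation ?p ?h = g A"
    proof cases
      case 1
      have "map_pmf ?h ?p = bind_pmf (random_partitioning A) (\<lambda>l.
           bind_pmf (random_partitioning (V - A)) (\<lambda>r. return_pmf (?h l)))"
        unfolding map using 1 tree(1)
        by (intro bind_pmf_cong refl) (auto simp: clustering_tree_def)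
      also have "\<dots> = map_pmf ?h (random_partitioning A)"
        by (simp add: map_pmf_def)
      finally have "measure_pmf.expectation ?p ?h = measure_pmf.expectation (random_partitioning A) ?h"
        by (rule expectation_cong_map_pmf)
      also have "\<dots> = g A" using A 1 psubset.prems by (subst psubset.IH) (auto simp: g_def f_def)
      finally show ?thesis .
    next
      case 2
      have "map_pmf ?h ?p = bind_pmf (random_partitioning A) (\<lambda>l.
           bind_pmf (random_partitioning (V - A)) (\<lambda>r. return_pmf (?h r)))"
        unfolding map using 2 psubset.prems tree
        by (intro bind_pmf_cong refl) (auto simp: clustering_tree_def)
      also have "\<dots> = map_pmf ?h (random_partitioning (V - A))"
        by (simp add: map_pmf_def)
      finally have "measure_pmf.expectation ?p ?h = measure_pmf.expectation (random_partitioning (V - A)) ?h"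
        by (rule expectation_cong_map_pmf)
      also have "\<dots> = g A" using A 2 psubset.prems by (subst psubset.IH) (auto simp: g_def f_def)
      finally show ?thesis .
    next
      case 3
      have "map_pmf ?h ?p = bind_pmf (random_partitioning A) (\<lambda>l.
           bind_pmf (random_partitioning (V - A)) (\<lambda>r. return_pmf (real ?m)))"
        unfolding map
      proof (intro bind_pmf_cong refl, goal_cases)
        case (1 l r)
        with tree have "leaves l = A" "leaves r = V - A" by (auto simp: clustering_tree_def)
        moreover have "A \<union> (V - A) = V" using A by auto
        ultimately show ?case using 3 by auto
      qed
      also have "\<dots> = map_pmf (\<lambda>_. real ?m) ?p"
        by (simp add: map_bind_pmf)
      finally have "measure_pmf.expectation ?p ?h = measure_pmf.expectation ?p (\<lambda>_. real ?m)"
        by (rule expectation_cong_map_pmf)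
      also have "\<dots> = g A" using 3 by (auto simp: g_def)
      finally show ?thesis .
    qed
    then show "measure_pmf.expectation ?p ?h / real (card (bipartitions V)) =
      g A / real (card (bipartitions V))" by simp
  qed
  also have "\<dots> = sum g (bipartitions V) / real (card (bipartitions V))"
    by (simp add: sum_divide_distrib)
  also have "sum g (bipartitions V) = real (card (bipartitions V)) * f ?m"
  proof -
    \<comment> \<open>Group the subsets of \<open>V\<close> by their intersection with \<open>V - {i, j}\<close>: the four values of \<open>g\<close> in a
      group always add up to \<open>4 * f (card V)\<close>.\<close>
    define U where "U = V - {i, j}"
    have V: "V = insert i (insert j U)" using psubset.prems by (auto simp: U_def)
    have U: "finite U" "i \<notin> U" "j \<notin> U" "i \<notin> insert j U"
      using psubset.hyps psubset.prems by (auto simp: U_def)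
    have cV: "?m = card U + 2" using U by (simp add: V)
    have "sum g (Pow V) = (\<Sum>A\<in>Pow U. (g A + g (insert j A)) + (g (insert i A) + g (insert i (insert j A))))"
      unfolding V using U by (simp add: sum_Pow_insert sum.distrib algebra_simps)
    also have "\<dots> = (\<Sum>A\<in>Pow U. 4 * f ?m)"
    proof (rule sum.cong[OF refl])
      fix A assume A: "A \<in> Pow U"
      then have ij: "i \<notin> A" "j \<notin> A" and finA: "finite A"
        using U by (auto intro: finite_subset)
      have "card A \<le> card U" using A U by (auto intro: card_mono)
      moreover have "card (V - A) = ?m - card A"
        using A finA by (intro card_Diff_subset) (auto simp: V)
      ultimately have "real (card (V - A)) = real ?m - real (card A)"
        using cV by (simp add: of_nat_diff)
      \<comment> \<open>With \<open>a = card A\<close> and \<open>m = card V\<close> the sum is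
        \<open>f (m - a) + m + m + f (a + 2)\<close>; \<open>f\<close> is affine, so
        \<open>a\<close> cancels.\<close>
      then show "(g A + g (insert j A)) + (g (insert i A) + g (insert i (insert j A))) = 4 * f ?m"
        using ij finA psubset.prems by (simp add: g_def f_def field_simps)
    qed
    also have "\<dots> = real (card (Pow V)) * f ?m"
      using U psubset.hyps by (simp add: card_Pow cV power_add)
    finally have all: "sum g (Pow V) = real (card (Pow V)) * f ?m" .
    have P: "Pow V = insert {} (insert V (bipartitions V))" using ne by auto
    have "sum g (Pow V) = g {} + (g V + sum g (bipartitions V))"
      unfolding P using finP ne by simp
    moreover have "card (Pow V) = 2 + card (bipartitions V)"
      unfolding P using finP ne by simp
    \<comment> \<open>The two excluded choices of the first side have exactly the mean value, so
      conditioning on both sides being nonempty does not change the mean.\<close>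
    moreover have "g {} = f ?m" "g V = f ?m" using psubset.prems by (auto simp: g_def)
    ultimately show ?thesis using all by (simp add: algebra_simps)
  qed
  also have "real (card (bipartitions V)) * f ?m / real (card (bipartitions V)) = f ?m"
    using iP finP by (simp add: card_eq_0_iff) blast
  finally show ?case by (simp add: f_def)
qed

lemma expected_revenue_random_partitioning:
  assumes "finite V" "V \<noteq> {}"
  shows "measure_pmf.expectation (random_partitioning V) (revenue w V) =
    2 / 3 * (real (card V) + 1) * total_weight w V"
proof -
  have "measure_pmf.expectation (random_partitioning V) (revenue w V) =
    (\<Sum>(i, j)\<in>edges V. w i j * measure_pmf.expectation (random_partitioning V)
        (\<lambda>T. real (card (leaves (lca_subtree i j T)))))"
    unfolding revenue_def
    by (subst Bochner_Integration.integral_sum)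
      (auto intro!: sum.cong integrable_measure_pmf_finite finite_set_random_partitioning assms)
  also have "\<dots> = (\<Sum>(i, j)\<in>edges V. w i j * (2 / 3 * (real (card V) + 1)))"
    using assms by (intro sum.cong) (auto dest!: edgesD simp: expected_lca_size)
  also have "\<dots> = 2 / 3 * (real (card V) + 1) * total_weight w V"
    unfolding total_weight_def sum_distrib_left by (intro sum.cong) auto
  finally show ?thesis .
qed

section \<open>Peeling off heavy vertices\<close>

locale clustering_instance =
  fixes n :: nat and w :: "nat \<Rightarrow> nat \<Rightarrow> real"
  assumes weighted: "weighted_instance n w"
begin

lemma w_nonneg: "i < n \<Longrightarrow> j < n \<Longrightarrow> 0 \<le> w i j"
  and w_sym: "i < n \<Longrightarrow> j < n \<Longrightarrow> w i j = w j i"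
  and n_pos: "0 < n"
  using weighted by (auto simp: weighted_instance_def)

lemma vertex_weight_nonneg:
  assumes "B \<subseteq> {..<n}" "v < n"
  shows "0 \<le> vertex_weight w B v"
  unfolding vertex_weight_def using assms by (intro sum_nonneg w_nonneg) auto

lemma vertex_weight_mono:
  assumes "B' \<subseteq> B" "B \<subseteq> {..<n}" "v < n"
  shows "vertex_weight w B' v \<le> vertex_weight w B v"
  unfolding vertex_weight_def
  using assms by (intro sum_mono2) (auto intro: w_nonneg finite_subset)

lemma cut_weight_nonneg:
  assumes "B \<subseteq> {..<n}"
  shows "0 \<le> cut_weight w B S"
  unfolding cut_weight_def using assms
  by (intro sum_nonneg) (auto simp: indicator_def dest!: edgesD intro!: w_nonneg)

lemma total_weight_nonneg:
  assumes "B \<subseteq> {..<n}"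
  shows "0 \<le> total_weight w B"
  unfolding total_weight_def using assms
  by (intro sum_nonneg) (auto dest!: edgesD intro!: w_nonneg)

lemma revenue_nonneg:
  assumes "B \<subseteq> {..<n}"
  shows "0 \<le> revenue w B T"
  unfolding revenue_def using assms
  by (intro sum_nonneg) (auto dest!: edgesD intro!: w_nonneg mult_nonneg_nonneg)

text \<open>Charge each crossing edge to its endpoint in \<open>S\<close>. Distinct edges give
  distinct ordered pairs, and edges inside \<open>S\<close> only enlarge the right-hand
  side.\<close>

lemma cut_weight_le_vertex_weights:
  assumes "B \<subseteq> {..<n}"
  shows "cut_weight w B S \<le> (\<Sum>v\<in>B \<inter> S. vertex_weight w B v)"
proof -
  have fin: "finite B" using assms by (rule finite_subset) simp
  have sym: "w i j = w j i" if "i \<in> B" "j \<in> B" for i j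
    using assms that by (intro w_sym) auto
  have "cut_weight w B S = (\<Sum>(i, j)\<in>crossing B S. if i \<in> S then w i j else w j i)"
    unfolding cut_weight_eq_sum_crossing[OF fin]
    by (intro sum.cong) (auto simp: crossing_def dest!: edgesD intro: sym)
  also have "\<dots> = (\<Sum>(v, u)\<in>(\<lambda>(i, j). if i \<in> S then (i, j) else (j, i)) ` crossing B S. w v u)"
    by (subst sum.reindex) (auto simp: inj_on_def crossing_def edges_def intro!: sum.cong split: if_splits)
  also have "\<dots> \<le> (\<Sum>(v, u)\<in>Sigma (B \<inter> S) (\<lambda>v. B - {v}). w v u)"
    using assms fin by (intro sum_mono2) (auto simp: crossing_def edges_def intro!: w_nonneg)
  also have "\<dots> = (\<Sum>v\<in>B \<inter> S. vertex_weight w B v)"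
    unfolding vertex_weight_def using fin by (subst sum.Sigma) auto
  finally show ?thesis .
qed

lemma cut_weight_singleton:
  assumes "B \<subseteq> {..<n}" "v \<in> B"
  shows "cut_weight w B {v} = vertex_weight w B v"
proof -
  have fin: "finite B" using assms(1) by (rule finite_subset) simp
  have sym: "w i j = w j i" if "i \<in> B" "j \<in> B" for i j
    using assms(1) that by (intro w_sym) auto
  have "(\<Sum>(i, j)\<in>crossing B {v}. w i j) = (\<Sum>u\<in>B - {v}. w v u)"
    using assms
    by (intro sum.reindex_bij_witness[where i = "\<lambda>u. (min u v, max u v)"
          and j = "\<lambda>(i, j). if i = v then j else i"])
      (auto simp: crossing_def edges_def min_def max_def intro: sym)
  then show ?thesis by (simp add: vertex_weight_def cut_weight_eq_sum_crossing[OF fin])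
qed

lemma total_weight_remove:
  assumes "B \<subseteq> {..<n}" "v \<in> B"
  shows "total_weight w B = total_weight w (B - {v}) + vertex_weight w B v"
proof -
  have "finite B" using assms(1) by (rule finite_subset) simp
  moreover have "edges {v} = {}" by (auto simp: edges_def)
  ultimately show ?thesis
    using assms total_weight_split[of B "{v}" w] cut_weight_singleton
    by (simp add: total_weight_def[of _ "{v}"])
qed

lemma revenue_peel:
  assumes "V \<subseteq> {..<n}" "v \<in> V" "leaves T = V - {v}"
  shows "revenue w V (Node (Leaf v) T) = revenue w (V - {v}) T + vertex_weight w V v * card V"
proof -
  have "revenue w V (Node (Leaf v) T) = revenue w (V \<inter> {v}) (Leaf v) + revenue w (V \<inter> (V - {v})) T +
    cut_weight w V {v} * card (insert v V)"
    using assms revenue_Node[of V "Leaf v" T w] by auto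
  moreover have "edges {v} = {}" by (auto simp: edges_def)
  moreover have "V \<inter> (V - {v}) = V - {v}" "insert v V = V" using assms by auto
  ultimately show ?thesis
    using assms by (simp add: revenue_def[of _ "{v}"] cut_weight_singleton)
qed

lemma ex_peel_off:
  assumes "finite V" "V \<noteq> {}"
  shows "\<exists>vs B. peel_off n w \<gamma> V vs B"
  using assms
proof (induction V rule: finite_psubset_induct)
  case (psubset V)
  show ?case
  proof (cases "\<exists>v. heavy n w \<gamma> V v")
    case False
    then show ?thesis by (blast intro: peel_off.stop)
  next
    case True
    then obtain u where u: "heavy n w \<gamma> V u" by blast
    have "Max (vertex_weight w V ` V) \<in> vertex_weight w V ` V"
      using psubset.hyps psubset.prems by (intro Max_in) auto
    then obtain v where v: "v \<in> V" "vertex_weight w V v = Max (vertex_weight w V ` V)"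
      by auto
    then have v: "v \<in> V" "\<forall>x\<in>V. vertex_weight w V x \<le> vertex_weight w V v"
      using psubset.hyps by auto
    have "heavy n w \<gamma> V v"
      using u v by (auto simp: heavy_def intro: order_trans)
    moreover have "V - {v} \<noteq> {}"
    proof
      assume "V - {v} = {}"
      with v have "V = {v}" by auto
      with u show False by (simp add: heavy_def)
    qed
    then obtain vs B where "peel_off n w \<gamma> (V - {v}) vs B"
      using psubset.IH[of "V - {v}"] v by blast
    ultimately show ?thesis using v by (blast intro: peel_off.peel)
  qed
qed

lemma peel_off_subset:
  "peel_off n w \<gamma> V vs B \<Longrightarrow> V \<noteq> {} \<Longrightarrow> B \<subseteq> V \<and> B \<noteq> {} \<and> (\<nexists>v. heavy n w \<gamma> B v)"
proof (induction rule: peel_off.induct)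
  case (peel V v vs B)
  have "V - {v} \<noteq> {}"
  proof
    assume "V - {v} = {}"
    with peel.hyps(1) have "V = {v}" by (auto simp: heavy_def)
    with peel.hyps(1) show False by (simp add: heavy_def)
  qed
  with peel.IH show ?case by auto
qed simp

lemma peel_off_card:
  "peel_off n w \<gamma> V vs B \<Longrightarrow> V \<subseteq> {..<n} \<Longrightarrow> card V = length vs + card B"
proof (induction rule: peel_off.induct)
  case (peel V v vs B)
  then have "v \<in> V" "finite V" by (auto simp: heavy_def intro: finite_subset)
  with peel show ?case by (cases "card V") auto
qed simp

lemma peel_off_removed_weight_ge:
  "peel_off n w \<gamma> V vs B \<Longrightarrow> V \<subseteq> {..<n} \<Longrightarrow>
    total_weight w V - total_weight w B \<ge> length vs * (\<gamma> * (2 * total_weight w {..<n} / real n))"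
proof (induction rule: peel_off.induct)
  case (peel V v vs B)
  define Q where "Q = \<gamma> * (2 * total_weight w {..<n} / real n)"
  from peel have "v \<in> V" "vertex_weight w V v \<ge> Q"
    by (auto simp: heavy_def Q_def)
  moreover have "length vs * Q \<le> total_weight w (V - {v}) - total_weight w B"
    using peel unfolding Q_def by auto
  ultimately show ?case
    using total_weight_remove[OF peel.prems, of v] unfolding Q_def[symmetric]
    by (simp add: distrib_right)
qed simp

text \<open>Removing vertices only lowers degrees, so a bound valid at the start holds in every
  step. It is applied with \<open>d\<close> the degree of a vertex just peeled off, to compare that
  vertex with all later ones.\<close>

lemma peel_off_removed_weight_le:
  "peel_off n w \<gamma> V vs B \<Longrightarrow> V \<subseteq> {..<n} \<Longrightarrow> (\<And>u. u \<in> V \<Longrightarrow> vertex_weight w V u \<le> d) \<Longrightarrow>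
    total_weight w V - total_weight w B \<le> real (length vs) * d"
proof (induction rule: peel_off.induct)
  case (peel V v vs B)
  then have v: "v \<in> V" by (auto simp: heavy_def)
  have "vertex_weight w (V - {v}) u \<le> d" if "u \<in> V - {v}" for u
    using vertex_weight_mono[of "V - {v}" V u] peel.prems that by fastforce
  with peel have "total_weight w (V - {v}) - total_weight w B \<le> length vs * d" by auto
  with total_weight_remove[OF peel.prems(1) v] peel.prems(2)[OF v] show ?case
    by (simp add: distrib_right)
qed simp

lemma clustering_tree_attach_peeled:
  "peel_off n w \<gamma> V vs B \<Longrightarrow> clustering_tree B T \<Longrightarrow> clustering_tree V (attach_peeled vs T)"
proof (induction rule: peel_off.induct)
  case (peel V v vs B)
  then have "v \<in> V" by (auto simp: heavy_def)
  with peel show ?case by (auto simp: attach_peeled_def clustering_tree_def)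
qed (simp add: attach_peeled_def)

text \<open>
  Vertices are peeled off in order of decreasing weight, so (Chebyshev) the removed weight is at
  least as large on average as if the removed edges were spread evenly over the steps.
\<close>

lemma revenue_attach_peeled:
  "peel_off n w \<gamma> V vs B \<Longrightarrow> clustering_tree B T \<Longrightarrow> V \<subseteq> {..<n} \<Longrightarrow>
    revenue w V (attach_peeled vs T) \<ge> revenue w B T +
      (total_weight w V - total_weight w B) * (card V - length vs / 2)"
proof (induction rule: peel_off.induct)
  case (stop V)
  then show ?case by (simp add: attach_peeled_def)
next
  case (peel V v vs B)
  from peel have v: "v \<in> V" by (auto simp: heavy_def)
  have fin: "finite V" using peel.prems by (auto intro: finite_subset)
  let ?T = "attach_peeled vs T" and ?k = "real (length vs)"
  define D where "D = total_weight w (V - {v}) - total_weight w B"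
  define d where "d = vertex_weight w V v"
  have tree: "clustering_tree (V - {v}) ?T"
    using peel by (intro clustering_tree_attach_peeled)
  then have "leaves ?T = V - {v}" by (simp add: clustering_tree_def)
  with v peel.prems have "revenue w V (attach_peeled (v # vs) T) = revenue w (V - {v}) ?T + d * card V"
    by (simp add: attach_peeled_def revenue_peel d_def)
  moreover have "revenue w (V - {v}) ?T \<ge> revenue w B T + D * (card (V - {v}) - ?k / 2)"
    using peel unfolding D_def by auto
  moreover have "real (card (V - {v})) = real (card V) - 1"
    using v fin by (cases "card V") auto
  moreover have "D \<le> ?k * d"
    unfolding D_def
  proof (rule peel_off_removed_weight_le[OF peel.hyps(3)])
    fix u assume "u \<in> V - {v}"
    then show "vertex_weight w (V - {v}) u \<le> d"
      using vertex_weight_mono[of "V - {v}" V u] peel.hyps(2) peel.prems unfolding d_def by fastforce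
  qed (use peel.prems in auto)
  moreover have "0 \<le> d" using v peel.prems unfolding d_def by (intro vertex_weight_nonneg) auto
  moreover have "total_weight w V - total_weight w B = D + d"
    using total_weight_remove[OF peel.prems(2) v] by (simp add: D_def d_def)
  \<comment> \<open>Given the induction hypothesis, the left side exceeds the right by at least
    \<open>(d + (?k * d - D)) / 2\<close>. An even spread would allow
    \<open>(length vs - 1) / 2\<close> for a list \<open>vs\<close>; the half vertex given away is
    the summand \<open>d / 2\<close>.\<close>
  ultimately show ?case by (simp add: field_simps)
qed

end

section \<open>Cuts along the spine of a tree\<close>

lemma sum_list_squares_le:
  fixes es :: "real list"
  assumes "\<And>e. e \<in> set es \<Longrightarrow> 0 \<le> e" "\<And>e. e \<in> set es \<Longrightarrow> e \<le> m"
  shows "(\<Sum>e\<leftarrow>es. e\<^sup>2) \<le> m * sum_list es"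
  using assms
proof (induction es)
  case (Cons a es)
  then have "a\<^sup>2 \<le> m * a" by (auto simp: power2_eq_square intro: mult_right_mono)
  with Cons show ?case by (auto simp: distrib_left)
qed simp

lemma sum_list_squares_le_square:
  fixes es :: "real list"
  assumes "\<And>e. e \<in> set es \<Longrightarrow> 0 \<le> e"
  shows "(\<Sum>e\<leftarrow>es. e\<^sup>2) \<le> (sum_list es)\<^sup>2"
  using sum_list_squares_le[of es "sum_list es"] assms member_le_sum_list[of _ es]
  by (simp add: power2_eq_square)

text \<open>By convexity the squares are largest when the sum is as concentrated as the cap
  \<open>Z\<close> permits: one entry \<open>Z\<close> and the rest merged into another. If some
  entry \<open>m\<close> exceeds half of the sum, merging the others gives
  \<open>m\<^sup>2 + (sum_list es - m)\<^sup>2\<close>, which grows with \<open>m\<close> up to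
  \<open>Z\<close>; otherwise half of the squared sum is already a bound.\<close>

lemma sum_list_squares_le_split:
  fixes es :: "real list"
  assumes nonneg: "\<And>e. e \<in> set es \<Longrightarrow> 0 \<le> e" and le: "\<And>e. e \<in> set es \<Longrightarrow> e \<le> Z"
    and Z: "sum_list es / 2 \<le> Z"
  shows "(\<Sum>e\<leftarrow>es. e\<^sup>2) \<le> Z\<^sup>2 + (sum_list es - Z)\<^sup>2"
proof (cases "\<forall>e\<in>set es. e \<le> sum_list es / 2")
  case True
  let ?E = "sum_list es"
  have "(\<Sum>e\<leftarrow>es. e\<^sup>2) \<le> ?E / 2 * ?E"
    using nonneg True by (intro sum_list_squares_le) auto
  also have "\<dots> \<le> Z\<^sup>2 + (?E - Z)\<^sup>2"
    using zero_le_power2[of "2 * Z - ?E"] by (simp add: power2_eq_square algebra_simps)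
  finally show ?thesis .
next
  case False
  let ?E = "sum_list es"
  from False obtain m where m: "m \<in> set es" "?E / 2 < m" by auto
  then obtain us vs where es: "es = us @ m # vs" by (auto simp: in_set_conv_decomp)
  have "(\<Sum>e\<leftarrow>us @ vs. e\<^sup>2) \<le> (sum_list (us @ vs))\<^sup>2"
    using nonneg by (intro sum_list_squares_le_square) (auto simp: es)
  then have "(\<Sum>e\<leftarrow>es. e\<^sup>2) \<le> m\<^sup>2 + (?E - m)\<^sup>2" by (simp add: es)
  also have "\<dots> \<le> Z\<^sup>2 + (?E - Z)\<^sup>2"
  proof -
    have "0 \<le> (Z - m) * (Z + m - ?E)"
      using m le[OF m(1)] by (intro mult_nonneg_nonneg) auto
    then show ?thesis by (simp add: power2_eq_square algebra_simps)
  qed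
  finally show ?thesis .
qed

lemma cut_weight_complement:
  assumes "C \<subseteq> A \<union> A'" "A \<inter> A' = {}"
  shows "cut_weight w C A = cut_weight w C A'"
proof -
  have "i \<in> A \<longleftrightarrow> i \<notin> A'" if "i \<in> C" for i using assms that by auto
  then show ?thesis
    unfolding cut_weight_def by (intro sum.cong) (auto simp: indicator_def dest!: edgesD)
qed

lemma edges_mono: "C \<subseteq> B \<Longrightarrow> edges C \<subseteq> edges B"
  by (auto simp: edges_def)

context clustering_instance
begin

lemma cut_weight_mono:
  assumes "C \<subseteq> B" "B \<subseteq> {..<n}"
  shows "cut_weight w C S \<le> cut_weight w B S"
proof -
  have "finite B" using assms(2) by (rule finite_subset) simp
  with assms show ?thesis
    unfolding cut_weight_def
    by (intro sum_mono2 finite_edges edges_mono)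
      (auto dest!: edgesD intro!: w_nonneg mult_nonneg_nonneg)
qed

lemma revenue_le:
  assumes "C \<subseteq> {..<n}" "card (leaves T) \<le> m"
  shows "revenue w C T \<le> m * total_weight w C"
proof -
  have "real (card (leaves (lca_subtree i j T))) \<le> m" for i j
    using card_leaves_lca_le[of i j T] assms(2) by linarith
  then have "w i j * real (card (leaves (lca_subtree i j T))) \<le> real m * w i j"
    if "i \<in> C" "j \<in> C" for i j
    using assms(1) that by (subst mult.commute) (auto intro!: mult_right_mono w_nonneg)
  then show ?thesis
    unfolding revenue_def total_weight_def sum_distrib_left
    by (intro sum_mono) (auto dest!: edgesD)
qed

text \<open>
  Walk down from the root always into the larger child; \<open>es\<close> lists the weights of the cuts made on
  the way. An edge of such a cut loses as much revenue as there are vertices already split off, and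
  these vertices, having degree at most \<open>q\<close>, are what bounds the weight of the earlier cuts. The
  edges inside a smaller child lose at least \<open>n / 2\<close>.
\<close>

lemma spine_cuts:
  fixes q Z D :: real
  assumes B: "B \<subseteq> {..<n}" and q: "\<And>v. v \<in> B \<Longrightarrow> vertex_weight w B v \<le> q" "0 \<le> q"
    and Z: "\<And>S. cut_weight w B S \<le> Z"
    and "distinct_leaves t" "leaves t \<subseteq> {..<n}" "D \<le> q * (real n - card (leaves t))"
  shows "\<exists>es. (\<forall>e\<in>set es. 0 \<le> e \<and> e \<le> Z) \<and> sum_list es \<le> total_weight w (B \<inter> leaves t) \<and>
    D * sum_list es + ((sum_list es)\<^sup>2 - (\<Sum>e\<leftarrow>es. e\<^sup>2)) / 2 +
      q * n / 2 * (total_weight w (B \<inter> leaves t) - sum_list es)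
    \<le> q * (n * total_weight w (B \<inter> leaves t) - revenue w (B \<inter> leaves t) t)"
  using assms(5-)
proof (induction t arbitrary: D)
  case (Leaf a)
  have "edges (B \<inter> {a}) = {}" by (auto simp: edges_def)
  then show ?case by (intro exI[of _ "[]"]) (simp add: total_weight_def revenue_def)
next
  case (Node l r)
  let ?t = "Node l r"
  define C where "C = B \<inter> leaves ?t"
  have C: "C \<subseteq> {..<n}" "finite C" using B by (auto simp: C_def intro: finite_subset)
  have disj: "leaves l \<inter> leaves r = {}" using Node.prems by simp
  \<comment> \<open>Stated for a smaller child \<open>a\<close> and a larger child \<open>b\<close>,
    so that both orders of \<open>l\<close> and \<open>r\<close> are instances; one of them needs
    the symmetry of the cut.\<close>
  have claim: ?case
    if card: "card (leaves a) \<le> card (leaves b)"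
      and ab: "leaves a \<union> leaves b = leaves ?t" "leaves a \<inter> leaves b = {}"
      and e: "e = cut_weight w C (leaves a)"
      and rev: "revenue w C ?t = revenue w (B \<inter> leaves a) a + revenue w (B \<inter> leaves b) b + e * card (leaves ?t)"
      and tot: "total_weight w C = total_weight w (B \<inter> leaves a) + total_weight w (B \<inter> leaves b) + e"
      and IH: "\<And>D. D \<le> q * (real n - card (leaves b)) \<Longrightarrow>
        \<exists>es. (\<forall>e\<in>set es. 0 \<le> e \<and> e \<le> Z) \<and> sum_list es \<le> total_weight w (B \<inter> leaves b) \<and>
        D * sum_list es + ((sum_list es)\<^sup>2 - (\<Sum>e\<leftarrow>es. e\<^sup>2)) / 2 +
          q * n / 2 * (total_weight w (B \<inter> leaves b) - sum_list es)
        \<le> q * (n * total_weight w (B \<inter> leaves b) - revenue w (B \<inter> leaves b) b)"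
    for a b :: "nat htree" and e :: real
  proof -
    have cards: "card (leaves ?t) = card (leaves a) + card (leaves b)"
      using card_Un_disjoint[OF finite_leaves finite_leaves ab(2)] ab(1) by simp
    have "card (leaves ?t) \<le> n"
      using card_mono[OF _ Node.prems(2)] by simp
    with card cards have half: "2 * card (leaves a) \<le> n" by linarith
    have e0: "0 \<le> e" unfolding e by (rule cut_weight_nonneg[OF C(1)])
    have eZ: "e \<le> Z"
      unfolding e by (rule order_trans[OF cut_weight_mono[OF _ B] Z]) (auto simp: C_def)
    have "e \<le> (\<Sum>v\<in>C \<inter> leaves a. vertex_weight w C v)"
      unfolding e by (rule cut_weight_le_vertex_weights[OF C(1)])
    also have "\<dots> \<le> (\<Sum>v\<in>C \<inter> leaves a. q)"
    proof (rule sum_mono)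
      fix v assume "v \<in> C \<inter> leaves a"
      then have v: "v \<in> B" by (simp add: C_def)
      then have "vertex_weight w C v \<le> vertex_weight w B v"
        using B by (intro vertex_weight_mono) (auto simp: C_def)
      with q(1)[OF v] show "vertex_weight w C v \<le> q" by simp
    qed
    also have "\<dots> \<le> q * card (leaves a)"
      using q(2) by (simp add: mult.commute mult_left_mono card_mono)
    finally have eq: "e \<le> q * card (leaves a)" .
    have "q * (real n - card (leaves ?t)) = q * (real n - card (leaves b)) - q * card (leaves a)"
      unfolding cards by (simp add: algebra_simps)
    \<comment> \<open>\<open>D\<close> is a lower estimate for \<open>q\<close> times the number of
      items already split off, and \<open>a\<close> adds at least \<open>e\<close> to it. Half of
      the squared sum minus the squares is the sum of products of cuts at two different positions;
      putting \<open>e\<close> in front adds \<open>e * sum_list es\<close>, which is what the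
      hypothesis yields when used with \<open>D + e\<close> instead of \<open>D\<close>.\<close>
    with eq Node.prems(3) have "D + e \<le> q * (real n - card (leaves b))" by linarith
    from IH[OF this] obtain es where es: "\<forall>e\<in>set es. 0 \<le> e \<and> e \<le> Z"
      "sum_list es \<le> total_weight w (B \<inter> leaves b)"
      and loss: "(D + e) * sum_list es + ((sum_list es)\<^sup>2 - (\<Sum>e\<leftarrow>es. e\<^sup>2)) / 2 +
          q * n / 2 * (total_weight w (B \<inter> leaves b) - sum_list es)
        \<le> q * (n * total_weight w (B \<inter> leaves b) - revenue w (B \<inter> leaves b) b)"
      by blast
    have tota: "0 \<le> total_weight w (B \<inter> leaves a)"
      using B by (intro total_weight_nonneg) auto
    have "revenue w (B \<inter> leaves a) a \<le> card (leaves a) * total_weight w (B \<inter> leaves a)"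
      using B by (intro revenue_le) auto
    also have "\<dots> \<le> n / 2 * total_weight w (B \<inter> leaves a)"
      using half tota by (intro mult_right_mono) auto
    finally have "q * (n / 2 * total_weight w (B \<inter> leaves a)) \<le>
        q * (n * total_weight w (B \<inter> leaves a) - revenue w (B \<inter> leaves a) a)"
      using q(2) by (intro mult_left_mono) auto
    moreover have "e * D \<le> e * (q * (real n - card (leaves ?t)))"
      using e0 Node.prems(3) by (intro mult_left_mono) auto
    ultimately have "D * sum_list (e # es) + ((sum_list (e # es))\<^sup>2 - (\<Sum>e\<leftarrow>e # es. e\<^sup>2)) / 2 +
      q * n / 2 * (total_weight w C - sum_list (e # es))
      \<le> q * (n * total_weight w C - revenue w C ?t)"
      using loss unfolding rev tot by (simp add: power2_eq_square field_simps)
    moreover have "sum_list (e # es) \<le> total_weight w C"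
      using es(2) tota unfolding tot by simp
    moreover have "\<forall>x\<in>set (e # es). 0 \<le> x \<and> x \<le> Z" using es(1) e0 eZ by simp
    ultimately show ?case unfolding C_def[symmetric] by blast
  qed
  have Cl: "C \<inter> leaves l = B \<inter> leaves l" and Cr: "C \<inter> leaves r = B \<inter> leaves r"
    and Cd: "C - B \<inter> leaves l = B \<inter> leaves r"
    using disj by (auto simp: C_def)
  have Ct: "C \<subseteq> leaves ?t" by (simp add: C_def)
  have rev: "revenue w C ?t = revenue w (B \<inter> leaves l) l + revenue w (B \<inter> leaves r) r +
      cut_weight w C (leaves l) * card (leaves ?t)"
    using revenue_Node[OF Ct disj, of w] by (simp only: Cl Cr)
  have "cut_weight w C (C \<inter> leaves l) = cut_weight w C (leaves l)"
    unfolding cut_weight_def by (intro sum.cong) (auto simp: indicator_def dest!: edgesD)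
  then have tot: "total_weight w C = total_weight w (B \<inter> leaves l) + total_weight w (B \<inter> leaves r) +
      cut_weight w C (leaves l)"
    using total_weight_split[OF C(2), of "C \<inter> leaves l" w, OF Int_lower1] by (simp only: Cl Cd Int_lower1 simp_thms)
  have sym: "cut_weight w C (leaves l) = cut_weight w C (leaves r)"
    using disj by (intro cut_weight_complement) (auto simp: C_def)
  consider "card (leaves l) \<le> card (leaves r)" | "card (leaves r) \<le> card (leaves l)" by linarith
  then show ?case
  proof cases
    case 1
    then show ?thesis
      using disj rev tot Node.IH(2) Node.prems
      by (intro claim[of l r "cut_weight w C (leaves l)"]) auto
  next
    case 2
    then show ?thesis
      using disj rev tot sym Node.IH(1) Node.prems
      by (intro claim[of r l "cut_weight w C (leaves l)"]) auto
  qed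
qed

text \<open>The loss of an edge, its weight times the difference between \<open>n\<close> and the
  size of its cluster, is nonnegative, so dropping the peeled edges can only lower the
  total.\<close>

lemma loss_mono:
  assumes "B \<subseteq> {..<n}" "leaves T = {..<n}"
  shows "n * total_weight w B - revenue w B T \<le>
    n * total_weight w {..<n} - revenue w {..<n} T"
proof -
  have eq: "n * total_weight w C - revenue w C T =
      (\<Sum>(i, j)\<in>edges C. w i j * (n - real (card (leaves (lca_subtree i j T)))))" for C
    unfolding total_weight_def revenue_def sum_distrib_left sum_subtractf[symmetric]
    by (intro sum.cong) (auto simp: algebra_simps)
  have "real (card (leaves (lca_subtree i j T))) \<le> n" for i j
    using card_leaves_lca_le[of i j T] assms(2) by simp
  with assms(1) show ?thesis
    unfolding eq
    by (intro sum_mono2 finite_edges edges_mono)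
      (auto dest!: edgesD intro!: w_nonneg mult_nonneg_nonneg)
qed

text \<open>With \<open>?E\<close> the total of the spine cuts, the left side is
  \<open>Z * (?E - Z)\<close> plus \<open>Z\<close> times the weight off the spine. The first part
  is covered by the products of different cuts, via the bound on squares; the second by the loss of
  \<open>n / 2\<close> per unit of weight, since \<open>Z \<le> q * n / 2\<close>. At the root
  nothing has been split off, so \<open>D = 0\<close>.\<close>

lemma max_cut_bound:
  fixes q Z :: real
  assumes B: "B \<subseteq> {..<n}" and q: "\<And>v. v \<in> B \<Longrightarrow> vertex_weight w B v \<le> q" "0 \<le> q"
    and Z: "\<And>S. cut_weight w B S \<le> Z" "total_weight w B / 2 \<le> Z" "Z \<le> q * n / 2"
    and T: "clustering_tree {..<n} T"
  shows "Z * (total_weight w B - Z) \<le> q * (n * total_weight w {..<n} - Rev n w T)"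
proof -
  have T': "leaves T = {..<n}" "distinct_leaves T" using T by (auto simp: clustering_tree_def)
  then have BT: "B \<inter> leaves T = B" using B by auto
  obtain es where es: "\<forall>e\<in>set es. 0 \<le> e \<and> e \<le> Z" "sum_list es \<le> total_weight w B"
    and loss: "0 * sum_list es + ((sum_list es)\<^sup>2 - (\<Sum>e\<leftarrow>es. e\<^sup>2)) / 2 +
      q * n / 2 * (total_weight w B - sum_list es)
    \<le> q * (n * total_weight w B - revenue w B T)"
    using spine_cuts[OF B q Z(1) T'(2), of 0] unfolding BT using T' by auto
  let ?E = "sum_list es"
  have "(\<Sum>e\<leftarrow>es. e\<^sup>2) \<le> Z\<^sup>2 + (?E - Z)\<^sup>2"
    using es Z by (intro sum_list_squares_le_split) auto
  then have "Z * (?E - Z) \<le> (?E\<^sup>2 - (\<Sum>e\<leftarrow>es. e\<^sup>2)) / 2"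
    by (simp add: power2_eq_square field_simps)
  moreover have "Z * (total_weight w B - ?E) \<le> q * n / 2 * (total_weight w B - ?E)"
    using es Z by (intro mult_right_mono) auto
  moreover have "q * (n * total_weight w B - revenue w B T) \<le>
      q * (n * total_weight w {..<n} - Rev n w T)"
    unfolding Rev_eq_revenue using q(2) by (intro mult_left_mono loss_mono B T')
  ultimately have "Z * (?E - Z) + Z * (total_weight w B - ?E) \<le>
      q * (n * total_weight w {..<n} - Rev n w T)"
    using loss by linarith
  moreover have "Z * (?E - Z) + Z * (total_weight w B - ?E) = Z * (total_weight w B - Z)"
    by (simp add: algebra_simps)
  ultimately show ?thesis by simp
qed

end

section \<open>The approximation ratio\<close>

lemma expectation_mono_finite:
  fixes f g :: "'a \<Rightarrow> real"
  assumes "finite (set_pmf p)" "\<And>x. x \<in> set_pmf p \<Longrightarrow> f x \<le> g x"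
  shows "measure_pmf.expectation p f \<le> measure_pmf.expectation p g"
  using assms by (intro integral_mono_AE) (auto simp: AE_measure_pmf_iff intro: integrable_measure_pmf_finite)

text \<open>The joint law \<open>q\<close> of both stages has \<open>p\<close> and the compound law
  as marginals, so the pointwise comparison can be integrated over it.\<close>

lemma expectation_bind_ge:
  fixes g :: "'a \<Rightarrow> real" and h :: "'b \<Rightarrow> real"
  assumes fin: "finite (set_pmf p)" "\<And>x. x \<in> set_pmf p \<Longrightarrow> finite (set_pmf (f x))"
    and le: "\<And>x y. x \<in> set_pmf p \<Longrightarrow> y \<in> set_pmf (f x) \<Longrightarrow> g x \<le> h y"
  shows "measure_pmf.expectation p g \<le> measure_pmf.expectation (bind_pmf p f) h"
proof -
  define q where "q = bind_pmf p (\<lambda>x. map_pmf (Pair x) (f x))"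
  have p: "map_pmf fst q = p"
    by (simp add: q_def map_bind_pmf pmf.map_comp o_def map_pmf_const bind_return_pmf')
  have b: "map_pmf snd q = bind_pmf p f"
    by (simp add: q_def map_bind_pmf pmf.map_comp o_def)
  have "measure_pmf.expectation q (g \<circ> fst) \<le> measure_pmf.expectation q (h \<circ> snd)"
    using fin le by (intro expectation_mono_finite) (auto simp: q_def)
  then have "measure_pmf.expectation (map_pmf fst q) g \<le> measure_pmf.expectation (map_pmf snd q) h"
    by (simp add: o_def)
  then show ?thesis unfolding p b .
qed

lemma expectation_better_tree:
  assumes "finite (set_pmf P)" "finite (set_pmf Q)"
  shows "measure_pmf.expectation (bind_pmf P (\<lambda>T1. bind_pmf Q (\<lambda>T2. return_pmf (better_tree n w T1 T2)))) (Rev n w)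
    \<ge> max (measure_pmf.expectation P (Rev n w)) (measure_pmf.expectation Q (Rev n w))"
proof -
  let ?better = "\<lambda>(T1, T2). better_tree n w T1 T2"
  have eq: "bind_pmf P (\<lambda>T1. bind_pmf Q (\<lambda>T2. return_pmf (better_tree n w T1 T2))) =
      map_pmf ?better (pair_pmf P Q)"
    by (simp add: pair_pmf_def map_bind_pmf)
  have fin: "finite (set_pmf (pair_pmf P Q))" using assms by simp
  have "measure_pmf.expectation (map_pmf fst (pair_pmf P Q)) (Rev n w) \<le>
      measure_pmf.expectation (map_pmf ?better (pair_pmf P Q)) (Rev n w)"
    unfolding integral_map_pmf using fin
    by (rule expectation_mono_finite) (auto simp: better_tree_def)
  moreover have "measure_pmf.expectation (map_pmf snd (pair_pmf P Q)) (Rev n w) \<le>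
      measure_pmf.expectation (map_pmf ?better (pair_pmf P Q)) (Rev n w)"
    unfolding integral_map_pmf using fin
    by (rule expectation_mono_finite) (auto simp: better_tree_def)
  ultimately show ?thesis by (simp add: eq map_fst_pair_pmf map_snd_pair_pmf)
qed

context clustering_instance
begin

lemma vertices_nonempty: "{..<n} \<noteq> {}"
  using n_pos by auto

text \<open>Cut edges have the root as least common ancestor, of size \<open>card B\<close>; the
  edges inside the two sides are only credited with a nonnegative revenue. A cut with an empty side
  has weight 0.\<close>

lemma cut_then_random_tree:
  assumes B: "B \<subseteq> {..<n}" "B \<noteq> {}" and S: "S \<subseteq> B"
    and T: "T \<in> set_pmf (cut_then_random B S)"
  shows "clustering_tree B T" "revenue w B T \<ge> card B * cut_weight w B S"
proof -
  have fin: "finite B" using B(1) by (rule finite_subset) simp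
  have "clustering_tree B T \<and> revenue w B T \<ge> card B * cut_weight w B S"
  proof (cases "S = {} \<or> S = B")
    case True
    then have "crossing B S = {}" by (auto simp: crossing_def edges_def)
    then have "cut_weight w B S = 0" using cut_weight_eq_sum_crossing[OF fin] by simp
    moreover have "clustering_tree B T"
      using T True random_partitioning_clustering_tree[OF fin B(2)] by (simp add: cut_then_random_def)
    ultimately show ?thesis using revenue_nonneg[OF B(1)] by simp
  next
    case False
    with T obtain l r where l: "l \<in> set_pmf (random_partitioning S)"
      and r: "r \<in> set_pmf (random_partitioning (B - S))" and T: "T = Node l r"
      by (auto simp: cut_then_random_def)
    have "clustering_tree S l" "clustering_tree (B - S) r"
      using random_partitioning_clustering_tree[OF _ _ l] random_partitioning_clustering_tree[OF _ _ r]
        False S fin by (auto intro: finite_subset)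
    then have lr: "leaves l = S" "leaves r = B - S" "distinct_leaves l" "distinct_leaves r"
      by (auto simp: clustering_tree_def)
    moreover have SB: "S \<union> (B - S) = B" using S by auto
    ultimately have "revenue w B T = revenue w (B \<inter> S) l + revenue w (B \<inter> (B - S)) r + cut_weight w B S * card B"
      using revenue_Node[of B l r w] by (simp add: T)
    moreover have "0 \<le> revenue w (B \<inter> S) l" "0 \<le> revenue w (B \<inter> (B - S)) r"
      using B(1) by (auto intro!: revenue_nonneg)
    ultimately show ?thesis using lr SB by (auto simp: T clustering_tree_def mult.commute)
  qed
  then show "clustering_tree B T" "revenue w B T \<ge> card B * cut_weight w B S" by auto
qed

lemma expectation_attach_peeled:
  assumes peel: "peel_off n w \<gamma> {..<n} vs B" and tree: "\<And>T. T \<in> set_pmf P \<Longrightarrow> clustering_tree B T"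
  shows "measure_pmf.expectation (map_pmf (attach_peeled vs) P) (Rev n w) \<ge>
    measure_pmf.expectation P (revenue w B) +
      (total_weight w {..<n} - total_weight w B) * (n - length vs / 2)"
proof -
  have "B \<subseteq> {..<n}" using peel_off_subset[OF peel] n_pos by auto
  then have "finite B" by (rule finite_subset) simp
  then have fin: "finite (set_pmf P)"
    using tree by (intro finite_subset[OF _ finite_clustering_trees]) auto
  let ?c = "(total_weight w {..<n} - total_weight w B) * (n - length vs / 2)"
  have "measure_pmf.expectation P (revenue w B) + ?c = measure_pmf.expectation P (\<lambda>T. revenue w B T + ?c)"
    using fin by (subst Bochner_Integration.integral_add) (auto intro: integrable_measure_pmf_finite)
  also have "\<dots> \<le> measure_pmf.expectation P (\<lambda>T. Rev n w (attach_peeled vs T))"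
    using fin revenue_attach_peeled[OF peel tree]
    by (intro expectation_mono_finite) (auto simp: Rev_eq_revenue)
  finally show ?thesis by simp
qed

lemma sdp_max_cut_bound:
  assumes peel: "peel_off n w \<gamma> {..<n} vs B" and opt: "sdp_optimal w B x"
    and T: "clustering_tree {..<n} T" and \<gamma>: "1 \<le> \<gamma>"
  shows "sdp_value w B x * (total_weight w B - sdp_value w B x) \<le>
    \<gamma> * (2 * total_weight w {..<n} / n) * (n * total_weight w {..<n} - Rev n w T)"
proof -
  let ?q = "\<gamma> * (2 * total_weight w {..<n} / n)"
  have B: "B \<subseteq> {..<n}" "\<nexists>v. heavy n w \<gamma> B v" using peel_off_subset[OF peel] n_pos by auto
  have fin: "finite B" using B(1) by (rule finite_subset) simp
  have W: "0 \<le> total_weight w {..<n}" by (rule total_weight_nonneg) simp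
  then have q: "0 \<le> ?q" using \<gamma> by simp
  \<comment> \<open>When the loop stops, no degree reaches the threshold. \<open>heavy\<close> is
    false for singleton clusters by definition, but there the degree is an empty sum.\<close>
  have deg: "vertex_weight w B v \<le> ?q" if v: "v \<in> B" for v
  proof (cases "2 \<le> card B")
    case True
    with B(2) v show ?thesis by (fastforce simp: heavy_def)
  next
    case False
    moreover have "0 < card B" using v fin by (auto simp: card_gt_0_iff)
    ultimately have "card B = 1" by simp
    with v have "B = {v}" by (auto simp: card_1_singleton_iff)
    with q show ?thesis by (simp add: vertex_weight_def)
  qed
  have "sdp_value w B x \<le> total_weight w B"
    using opt B(1) by (intro sdp_value_le_total) (auto simp: sdp_optimal_def intro!: w_nonneg)
  also have "\<dots> \<le> total_weight w {..<n}"
    unfolding total_weight_def using B(1)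
    by (intro sum_mono2 finite_edges edges_mono) (auto dest!: edgesD intro!: w_nonneg)
  also have "\<dots> \<le> \<gamma> * total_weight w {..<n}" using mult_right_mono[OF \<gamma> W] by simp
  also have "\<dots> = ?q * n / 2" using n_pos by simp
  finally show ?thesis
    by (intro max_cut_bound B(1) deg q T sdp_optimal_ge_cut[OF fin opt] sdp_optimal_ge_half[OF fin opt])
qed

end

section \<open>Numerical inequalities for the two branches\<close>

lemma random_case_bound:
  fixes r :: real
  assumes "0.22 < r"
  shows "0.6929 \<le> r * (1 - r / 6) + (1 - r / 3) * (2 / 3 * (1 - r))"
proof -
  have "0.22 * 0.22 \<le> r * r" using assms by (intro mult_mono) auto
  \<comment> \<open>The right-hand side expands to \<open>2 / 3 + r / 9 + r * r / 18\<close>, which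
    increases for positive \<open>r\<close> and is about 0.6938 at 0.22.\<close>
  then show ?thesis using assms by (simp add: field_simps)
qed

lemma cut_case_bound:
  fixes r z \<epsilon> :: real
  assumes r: "0 \<le> r" "r \<le> 0.22" and \<epsilon>: "0 \<le> \<epsilon>" "\<epsilon> \<le> 0.0379"
    and z: "(1 - r) / 2 \<le> z" "z * (1 - r - z) \<le> 3 * \<epsilon>"
  shows "0.6929 * (1 - \<epsilon>) \<le> r * (1 - r / 6) + (1 - r / 3) * (0.85 * z)"
proof -
  \<comment> \<open>The slope must satisfy \<open>5.2 * y \<ge> 3\<close> on the whole range. There
    \<open>y\<close> is at least \<open>0.78 - 5.2 * 0.0379 = 0.58292\<close>, used below as 0.5828,
    and \<open>5.2 * 0.5828\<close> exceeds 3.\<close>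
  define y where "y = 1 - r - 5.2 * \<epsilon>"
  have "y \<le> z"
  proof (rule ccontr)
    assume "\<not> y \<le> z"
    \<comment> \<open>To the right of \<open>(1 - r) / 2\<close> the function
      \<open>t * (1 - r - t)\<close> decreases, so \<open>z < y\<close> would give it a larger value
      at \<open>z\<close> than at \<open>y\<close>.\<close>
    then have "0 < (y - z) * (y + z - (1 - r))" using z(1) by (intro mult_pos_pos) auto
    then have "y * (1 - r - y) < z * (1 - r - z)" by (simp add: algebra_simps)
    moreover have "3 * \<epsilon> \<le> y * (5.2 * \<epsilon>)"
    proof -
      have "3 * \<epsilon> \<le> 0.5828 * (5.2 * \<epsilon>)" using \<epsilon> by simp
      also have "\<dots> \<le> y * (5.2 * \<epsilon>)"
        using r \<epsilon> by (intro mult_right_mono) (auto simp: y_def)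
      finally show ?thesis .
    qed
    ultimately show False using z(2) by (simp add: y_def)
  qed
  then have "(1 - r / 3) * (0.85 * y) \<le> (1 - r / 3) * (0.85 * z)"
    using r by (intro mult_left_mono) auto
  moreover have "0.6929 * (1 - \<epsilon>) \<le> r * (1 - r / 6) + (1 - r / 3) * (0.85 * y)"
  proof -
    \<comment> \<open>After expansion \<open>r * \<epsilon>\<close> and \<open>r * r\<close> have
      positive coefficients in the difference of the two sides. These products bound both from below
      by linear functions that are exact at the worst corner \<open>r = 0.22\<close>,
      \<open>\<epsilon> = 0.0379\<close>; what remains is linear.\<close>
    have "0 \<le> (0.22 - r) * (0.0379 - \<epsilon>)" "0 \<le> (0.22 - r) * (0.22 - r)"
      using r \<epsilon> by (auto intro: mult_nonneg_nonneg)
    then show ?thesis using r \<epsilon> unfolding y_def by (simp add: field_simps)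
  qed
  ultimately show ?thesis by linarith
qed

section \<open>Expected revenue of the combined algorithm\<close>

context clustering_instance
begin

text \<open>\<open>G\<close> is the expected revenue per vertex of the remaining cluster, for either kind of run.\<close>

lemma PMR_revenue_normalized:
  fixes G :: real
  assumes peel: "peel_off n w (3 / 2) {..<n} vs B" and tree: "\<And>T. T \<in> set_pmf P \<Longrightarrow> clustering_tree B T"
    and G: "card B * G \<le> measure_pmf.expectation P (revenue w B)" "0 \<le> G"
    and W: "0 < total_weight w {..<n}"
  defines "r \<equiv> removed_fraction n w B"
  shows "n * total_weight w {..<n} * (r * (1 - r / 6) + (1 - r / 3) * (G / total_weight w {..<n})) \<le>
    measure_pmf.expectation (map_pmf (attach_peeled vs) P) (Rev n w)"
proof -
  let ?W = "total_weight w {..<n}"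
  define k where "k = real (length vs)"
  have D: "?W - total_weight w B = r * ?W" using W by (simp add: r_def removed_fraction_def)
  have card: "real (card B) = n - k" using peel_off_card[OF peel] by (simp add: k_def)
  have "k * (3 / 2 * (2 * ?W / n)) \<le> r * ?W"
    using peel_off_removed_weight_ge[OF peel] unfolding D by (simp add: k_def)
  then have "(3 * k) * ?W \<le> (r * n) * ?W" using n_pos by (simp add: field_simps)
  then have k: "3 * k \<le> r * n" using W by (simp only: mult_le_cancel_right_pos)
  have "total_weight w B \<le> ?W"
  proof -
    have "0 \<le> length vs * (3 / 2 * (2 * ?W / n))" using W by simp
    with peel_off_removed_weight_ge[OF peel] show ?thesis by simp
  qed
  then have "0 \<le> r * ?W" using D by simp
  then have r0: "0 \<le> r" using W by (simp add: zero_le_mult_iff)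
  \<comment> \<open>The bound on \<open>k\<close> enters twice: half of \<open>k\<close> lowers the
    average size at which the removed weight is earned, giving \<open>r / 6\<close>, and all of
    \<open>k\<close> is missing from the remaining cluster, giving \<open>r / 3\<close>.\<close>
  have "r * ?W * (n - k / 2) \<ge> r * ?W * (n - r * n / 6)"
    using k r0 W by (intro mult_left_mono) auto
  moreover have "(n - k) * G \<ge> (n - r * n / 3) * G"
    using k G by (intro mult_right_mono) auto
  moreover have "n * ?W * (r * (1 - r / 6) + (1 - r / 3) * (G / ?W)) =
      r * ?W * (n - r * n / 6) + (n - r * n / 3) * G"
    using W by (simp add: field_simps)
  ultimately show ?thesis
    using expectation_attach_peeled[OF peel, of P, OF tree] G(1) unfolding D card k_def[symmetric] by linarith
qed

lemma PMR_clustering_tree: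
  assumes "P \<in> PMR \<gamma> Rstar n w" "T \<in> set_pmf P"
  shows "clustering_tree {..<n} T"
proof -
  have ne: "B \<subseteq> {..<n}" "finite B" "B \<noteq> {}" if "peel_off n w \<gamma> {..<n} vs B" for vs B
    using peel_off_subset[OF that] n_pos by (auto intro: finite_subset)
  from assms(1) consider
      (random) vs B where "P = map_pmf (attach_peeled vs) (random_partitioning B)"
        "peel_off n w \<gamma> {..<n} vs B"
    | (cut) vs B x where
        "P = map_pmf (attach_peeled vs) (bind_pmf (hyperplane_rounding B x) (cut_then_random B))"
        "peel_off n w \<gamma> {..<n} vs B"
    unfolding PMR_def by blast
  then show ?thesis
  proof cases
    case random
    with assms(2) show ?thesis
      using ne[OF random(2)]
      by (auto intro!: clustering_tree_attach_peeled random_partitioning_clustering_tree)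
  next
    case cut
    note B = ne[OF cut(2)]
    from assms(2) cut(1) obtain S T' where "S \<in> set_pmf (hyperplane_rounding B x)"
      "T' \<in> set_pmf (cut_then_random B S)" "T = attach_peeled vs T'" by auto
    then show ?thesis
      using clustering_tree_attach_peeled[OF cut(2)] cut_then_random_tree(1)[OF B(1,3), of S T']
        set_hyperplane_rounding[OF B(2), of x] by auto
  qed
qed

text \<open>This rests on the semidefinite optimum being attained; otherwise the cut branch would
  have no run at all.\<close>

lemma PMR_nonempty: "PMR \<gamma> Rstar n w \<noteq> {}"
proof -
  obtain vs B where peel: "peel_off n w \<gamma> {..<n} vs B"
    using ex_peel_off[OF finite_lessThan vertices_nonempty] by blast
  have "B \<subseteq> {..<n}" using peel_off_subset[OF peel] n_pos by auto
  then have "finite B" by (rule finite_subset) simp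
  then obtain x where "sdp_optimal w B x" using ex_sdp_optimal by blast
  with peel show ?thesis unfolding PMR_def by blast
qed

lemma expected_revenue_PMR:
  assumes P: "P \<in> PMR (3 / 2) 0.22 n w" and W: "0 < total_weight w {..<n}"
    and T: "clustering_tree {..<n} T"
    and \<epsilon>: "Rev n w T = (1 - \<epsilon>) * (n * total_weight w {..<n})" "\<epsilon> \<le> 0.0379"
  shows "0.6929 * Rev n w T \<le> measure_pmf.expectation P (Rev n w)"
proof -
  let ?W = "total_weight w {..<n}"
  have nW: "0 < n * ?W" using n_pos W by simp
  have "Rev n w T \<le> n * ?W"
    unfolding Rev_eq_revenue using T by (intro revenue_le) (auto simp: clustering_tree_def)
  then have "0 \<le> \<epsilon> * (n * ?W)" unfolding \<epsilon> by (simp add: algebra_simps)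
  then have \<epsilon>0: "0 \<le> \<epsilon>" using nW by (simp add: zero_le_mult_iff)
  have goal: ?thesis
    if "n * ?W * b \<le> measure_pmf.expectation P (Rev n w)" "0.6929 * (1 - \<epsilon>) \<le> b" for b
  proof -
    have "0.6929 * Rev n w T = n * ?W * (0.6929 * (1 - \<epsilon>))" unfolding \<epsilon> by simp
    also have "\<dots> \<le> n * ?W * b" using that(2) nW by (intro mult_left_mono) auto
    finally show ?thesis using that(1) by simp
  qed
  from P consider
      (random) vs B where "P = map_pmf (attach_peeled vs) (random_partitioning B)"
        "peel_off n w (3 / 2) {..<n} vs B" "0.22 < removed_fraction n w B"
    | (cut) vs B x where
        "P = map_pmf (attach_peeled vs) (bind_pmf (hyperplane_rounding B x) (cut_then_random B))"
        "peel_off n w (3 / 2) {..<n} vs B" "removed_fraction n w B \<le> 0.22" "sdp_optimal w B x"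
    unfolding PMR_def by force
  then show ?thesis
  proof cases
    case random
    let ?r = "removed_fraction n w B"
    have B: "B \<subseteq> {..<n}" "B \<noteq> {}" using peel_off_subset[OF random(2)] n_pos by auto
    then have fin: "finite B" by (auto intro: finite_subset)
    have WB: "total_weight w B / ?W = 1 - ?r"
      using W by (simp add: removed_fraction_def field_simps)
    \<comment> \<open>The summand 1 in \<open>card B + 1\<close> is given up, so that this branch
      has the common form \<open>card B * G\<close>; in the other branch \<open>G\<close> is
      \<open>0.85 * ?Z\<close>.\<close>
    have "card B * (2 / 3 * total_weight w B) \<le> 2 / 3 * (real (card B) + 1) * total_weight w B"
      using total_weight_nonneg[OF B(1)] by (simp add: algebra_simps)
    then have "n * ?W * (?r * (1 - ?r / 6) + (1 - ?r / 3) * (2 / 3 * total_weight w B / ?W)) \<le>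
        measure_pmf.expectation P (Rev n w)"
      unfolding random(1) using total_weight_nonneg[OF B(1)] B fin W
      by (intro PMR_revenue_normalized[OF random(2)])
        (auto simp: expected_revenue_random_partitioning intro!: random_partitioning_clustering_tree)
    moreover have "0.6929 * (1 - \<epsilon>) \<le> ?r * (1 - ?r / 6) + (1 - ?r / 3) * (2 / 3 * total_weight w B / ?W)"
      using random_case_bound[OF random(3)] \<epsilon>0 unfolding WB[symmetric] by simp
    ultimately show ?thesis by (rule goal)
  next
    case cut
    let ?r = "removed_fraction n w B" and ?Z = "sdp_value w B x"
    let ?Q = "bind_pmf (hyperplane_rounding B x) (cut_then_random B)"
    have B: "B \<subseteq> {..<n}" "B \<noteq> {}" using peel_off_subset[OF cut(2)] n_pos by auto
    then have fin: "finite B" by (auto intro: finite_subset)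
    have WB: "total_weight w B = (1 - ?r) * ?W"
      using W by (simp add: removed_fraction_def field_simps)
    have sub: "S \<subseteq> B" if "S \<in> set_pmf (hyperplane_rounding B x)" for S
      using set_hyperplane_rounding[OF fin] that by auto
    have finS: "finite (set_pmf (hyperplane_rounding B x))"
      using set_hyperplane_rounding[OF fin] fin by (meson finite_Pow_iff finite_subset)
    have tree: "clustering_tree B T" if "T \<in> set_pmf ?Q" for T
    proof -
      from that obtain S where "S \<in> set_pmf (hyperplane_rounding B x)"
        "T \<in> set_pmf (cut_then_random B S)" by auto
      with sub cut_then_random_tree(1)[OF B] show ?thesis by blast
    qed
    have finC: "finite (set_pmf (cut_then_random B S))" if "S \<subseteq> B" for S
      using cut_then_random_tree(1)[OF B that]
      by (intro finite_subset[OF _ finite_clustering_trees[OF fin]]) auto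
    have half: "total_weight w B / 2 \<le> ?Z" by (rule sdp_optimal_ge_half[OF fin cut(4)])
    have "card B * (0.85 * ?Z) \<le> card B * measure_pmf.expectation (hyperplane_rounding B x) (cut_weight w B)"
      using B cut(4)
      by (intro mult_left_mono expected_cut_weight[OF fin]) (auto simp: sdp_optimal_def intro!: w_nonneg)
    also have "\<dots> = measure_pmf.expectation (hyperplane_rounding B x) (\<lambda>S. card B * cut_weight w B S)"
      by simp
    also have "\<dots> \<le> measure_pmf.expectation ?Q (revenue w B)"
      using sub finC finS cut_then_random_tree(2)[OF B] by (intro expectation_bind_ge) auto
    finally have "n * ?W * (?r * (1 - ?r / 6) + (1 - ?r / 3) * (0.85 * ?Z / ?W)) \<le>
        measure_pmf.expectation P (Rev n w)"
      unfolding cut(1) using half total_weight_nonneg[OF B(1)] tree W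
      by (intro PMR_revenue_normalized[OF cut(2)]) auto
    moreover have "0.6929 * (1 - \<epsilon>) \<le> ?r * (1 - ?r / 6) + (1 - ?r / 3) * (0.85 * (?Z / ?W))"
    proof (rule cut_case_bound)
      have "total_weight w B \<le> ?W"
        unfolding total_weight_def using B(1)
        by (intro sum_mono2 finite_edges edges_mono) (auto dest!: edgesD intro!: w_nonneg)
      then show "0 \<le> ?r" using W by (simp add: removed_fraction_def)
      show "(1 - ?r) / 2 \<le> ?Z / ?W" using half W unfolding WB by (simp add: field_simps)
      have "?Z * (total_weight w B - ?Z) \<le> 3 / 2 * (2 * ?W / n) * (n * ?W - Rev n w T)"
        by (rule sdp_max_cut_bound[OF cut(2,4) T]) simp
      also have "\<dots> = 3 * \<epsilon> * ?W\<^sup>2"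
        unfolding \<epsilon> using n_pos by (simp add: field_simps power2_eq_square)
      finally have "?Z * ((1 - ?r) * ?W - ?Z) / ?W\<^sup>2 \<le> 3 * \<epsilon>"
        unfolding WB using W by (simp add: pos_divide_le_eq)
      moreover have "?Z * ((1 - ?r) * ?W - ?Z) / ?W\<^sup>2 = ?Z / ?W * (1 - ?r - ?Z / ?W)"
        using W by (simp add: field_simps power2_eq_square)
      ultimately show "?Z / ?W * (1 - ?r - ?Z / ?W) \<le> 3 * \<epsilon>" by simp
    qed (use \<epsilon> \<epsilon>0 cut in auto)
    ultimately show ?thesis by (intro goal) auto
  qed
qed

lemma best_of_PMR_and_random_revenue:
  assumes P: "P \<in> PMR (3 / 2) 0.22 n w"
  shows "0.6929 * OPT n w \<le> measure_pmf.expectation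
    (bind_pmf P (\<lambda>T1. bind_pmf (random_partitioning {..<n}) (\<lambda>T2.
      return_pmf (better_tree n w T1 T2)))) (Rev n w)"
proof -
  let ?W = "total_weight w {..<n}" and ?R = "random_partitioning {..<n}"
  have V: "finite {..<n}" "{..<n} \<noteq> {}" using n_pos by auto
  have finR: "finite (set_pmf ?R)" by (rule finite_set_random_partitioning[OF V])
  have finP: "finite (set_pmf P)"
    using PMR_clustering_tree[OF P] by (intro finite_subset[OF _ finite_clustering_trees[OF V(1)]]) auto
  have "{T. clustering_tree {..<n} T} \<noteq> {}"
    using random_partitioning_clustering_tree[OF V] set_pmf_not_empty[of ?R] by blast
  then have "OPT n w \<in> Rev n w ` {T. clustering_tree {..<n} T}"
    unfolding OPT_def by (intro Max_in) (auto simp: finite_clustering_trees)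
  then obtain T where T: "clustering_tree {..<n} T" "OPT n w = Rev n w T" by auto
  have le: "Rev n w T \<le> n * ?W"
    unfolding Rev_eq_revenue using T(1) by (intro revenue_le) (auto simp: clustering_tree_def)
  have W0: "0 \<le> ?W" by (rule total_weight_nonneg) simp
  have R: "2 / 3 * (n * ?W) \<le> measure_pmf.expectation ?R (Rev n w)"
    unfolding Rev_eq_revenue expected_revenue_random_partitioning[OF V] using W0
    by (simp add: algebra_simps)
  have "0.6929 * Rev n w T \<le> max (measure_pmf.expectation P (Rev n w)) (measure_pmf.expectation ?R (Rev n w))"
  proof (cases "0.6929 * Rev n w T \<le> 2 / 3 * (n * ?W)")
    case True
    with R show ?thesis by linarith
  next
    case False
    \<comment> \<open>With total weight 0 the revenue of \<open>T\<close> would be at most 0, which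
      belongs to the other case.\<close>
    with le W0 have W: "0 < ?W" by (cases "?W = 0") auto
    then have nW: "0 < n * ?W" using n_pos by simp
    define \<epsilon> where "\<epsilon> = 1 - Rev n w T / (n * ?W)"
    have \<epsilon>: "Rev n w T = (1 - \<epsilon>) * (n * ?W)" using W n_pos by (simp add: \<epsilon>_def)
    have "2 / 3 * (n * ?W) < 0.6929 * (1 - \<epsilon>) * (n * ?W)"
      using False unfolding \<epsilon> mult.assoc by (simp only: not_le)
    then have "2 / 3 < 0.6929 * (1 - \<epsilon>)" using nW by (simp only: mult_less_cancel_right_pos)
    \<comment> \<open>\<open>1 - (2 / 3) / 0.6929\<close> is about 0.03786.\<close>
    then have "\<epsilon> \<le> 0.0379" by simp
    from expected_revenue_PMR[OF P W T(1) \<epsilon> this] show ?thesis by simp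
  qed
  also have "\<dots> \<le> measure_pmf.expectation
    (bind_pmf P (\<lambda>T1. bind_pmf ?R (\<lambda>T2. return_pmf (better_tree n w T1 T2)))) (Rev n w)"
    by (rule expectation_better_tree[OF finP finR])
  finally show ?thesis by (simp add: T)
qed

end

theorem theorem3:
  shows "\<exists>\<gamma> Rstar :: real. 1 \<le> \<gamma> \<and> 0 < Rstar \<and> Rstar < 1 / 2 \<and>
    approximation_algorithm 0.6929 (best_of_PMR_and_random \<gamma> Rstar)"
proof (rule exI[of _ "3 / 2"], rule exI[of _ "0.22"], intro conjI)
  show "approximation_algorithm 0.6929 (best_of_PMR_and_random (3 / 2) 0.22)"
    unfolding approximation_algorithm_def
  proof (intro allI impI conjI ballI)
    fix n w assume inst: "weighted_instance n w"
    interpret clustering_instance n w by standard (rule inst)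
    show "best_of_PMR_and_random (3 / 2) 0.22 n w \<noteq> {}"
      using PMR_nonempty unfolding best_of_PMR_and_random_def by blast
    fix D assume "D \<in> best_of_PMR_and_random (3 / 2) 0.22 n w"
    then obtain P where P: "P \<in> PMR (3 / 2) 0.22 n w"
      and D: "D = bind_pmf P (\<lambda>T1. bind_pmf (random_partitioning {..<n}) (\<lambda>T2.
        return_pmf (better_tree n w T1 T2)))"
      unfolding best_of_PMR_and_random_def by blast
    show "0.6929 * OPT n w \<le> measure_pmf.expectation D (Rev n w)"
      unfolding D by (rule best_of_PMR_and_random_revenue[OF P])
    fix T assume "T \<in> set_pmf D"
    then obtain T1 T2 where "T1 \<in> set_pmf P" "T2 \<in> set_pmf (random_partitioning {..<n})"
      "T = better_tree n w T1 T2" by (auto simp: D)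
    then show "clustering_tree {..<n} T"
      using PMR_clustering_tree[OF P] random_partitioning_clustering_tree[OF finite_lessThan vertices_nonempty]
      by (simp add: better_tree_def)
  qed
qed auto

end
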